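(* Let $n\geq 7$ and let $G\in\mathfrak{C}_{n,1}$. Then $W(G)\leq W(L_{n,n-1})$, and equality holds if and only if $G\cong L_{n,n-1}$.
   Context: All graphs are simple, finite, connected and undirected. A cut vertex of a graph is a vertex whose removal makes the graph disconnected. $\mathfrak{C}_{n,k}$ denotes the set of all connected graphs on $n$ vertices with exactly $k$ cut vertices. The Wiener index $W(G)$ is the sum of the distances $d(u,v)$ (number of edges of a shortest path) over all unordered pairs of vertices $\{u,v\}$ of $G$. $P_m$ and $C_m$ are the path and the cycle on $m$ vertices. For $3\leq g\leq n-1$, $L_{n,g}$ is the graph on $n$ vertices obtained by identifying a pendant (degree one) vertex of the path $P_{n-g+1}$ with a vertex of the cycle $C_g$. The symbol $\cong$ denotes graph isomorphism. *)

theory Defs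
  imports "Graph_Theory.Graph_Theory"
begin

text \<open>
  A finite simple undirected graph is a \<open>pair_graph\<close>: a finite vertex set together with a
  symmetric irreflexive set of ordered pairs, each edge being represented by its two arcs.
\<close>

text \<open>
  The library counts the null graph as disconnected; the nonemptiness condition keeps the only
  vertex of the one-vertex graph from being a cut vertex.
\<close>

definition cut_vertex :: "('a, 'b) pre_digraph \<Rightarrow> 'a \<Rightarrow> bool" where
  "cut_vertex G v \<longleftrightarrow> v \<in> verts G \<and> verts (pre_digraph.del_vert G v) \<noteq> {} \<and>
     \<not> connected (pre_digraph.del_vert G v)"

definition graphs_with_cut_vertices :: "nat \<Rightarrow> nat \<Rightarrow> 'a pair_pre_digraph set" where
  "graphs_with_cut_vertices n k =
     {G. pair_graph G \<and> connected (with_proj G) \<and> card (pverts G) = n \<and>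
         card {v. cut_vertex (with_proj G) v} = k}"

text \<open>The distance is the minimal cost of a walk when every arc has weight one.\<close>

definition distance :: "('a, 'b) pre_digraph \<Rightarrow> 'a \<Rightarrow> 'a \<Rightarrow> ereal" where
  "distance G u v = wf_digraph.\<mu> G (\<lambda>_. 1) u v"

text \<open>
  The distance between the two members of an unordered pair. The description is well defined
  because the distance is symmetric in an undirected graph, see \<open>pair_distance_doubleton\<close>.
\<close>

definition pair_distance :: "('a, 'b) pre_digraph \<Rightarrow> 'a set \<Rightarrow> ereal" where
  "pair_distance G e = (THE d. \<exists>u v. e = {u, v} \<and> d = distance G u v)"

definition wiener_index :: "('a, 'b) pre_digraph \<Rightarrow> ereal" where
  "wiener_index G = (\<Sum>e | e \<subseteq> verts G \<and> card e = 2. pair_distance G e)"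

text \<open>
  The cycle on \<open>0, \<dots>, g - 1\<close> and the path on \<open>g - 1, \<dots>, n - 1\<close>, glued at their common
  vertex \<open>g - 1\<close>. Meant for \<open>3 \<le> g \<le> n - 1\<close>.
\<close>

definition lollipop :: "nat \<Rightarrow> nat \<Rightarrow> nat pair_pre_digraph" where
  "lollipop n g =
     (let cycle_edges = {(i, i + 1) | i. i + 1 < g} \<union> {(g - 1, 0)};
          path_edges = {(i, i + 1) | i. g - 1 \<le> i \<and> i + 1 < n};
          E = cycle_edges \<union> path_edges
      in \<lparr> pverts = {..<n}, parcs = E \<union> E\<inverse> \<rparr>)"

lemma pair_graph_lollipop:
  assumes "3 \<le> g" "g \<le> n - 1"
  shows "pair_graph (lollipop n g)"
proof -
  have "parcs (lollipop n g) \<subseteq> {..<n} \<times> {..<n}"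
    using assms by (auto simp: lollipop_def Let_def)
  then have "finite (parcs (lollipop n g))"
    by (rule finite_subset) simp
  then show ?thesis
    using assms by unfold_locales (auto simp: lollipop_def Let_def symmetric_def sym_def)
qed

lemma distance_le_swap:
  assumes "pair_sym_digraph G"
  shows "distance (with_proj G) u v \<le> distance (with_proj G) v u"
proof -
  interpret pair_sym_digraph G by fact
  have rev: "awalk u (rev (map prod.swap p)) v" if "awalk v p u" for p
    using that
  proof (induction p arbitrary: v)
    case Nil
    then show ?case by (auto simp: awalk_Nil_iff)
  next
    case (Cons e p)
    obtain a b where e: "e = (a, b)" by (cases e)
    from Cons.prems e have h: "a = v" "(v, b) \<in> parcs G" "awalk b p u"
      by (auto simp: awalk_Cons_iff)
    then have "(b, v) \<in> parcs G"
      using pair_sym_arcs by (auto simp: symmetric_def sym_def)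
    then have "awalk b [(b, v)] v"
      by (auto simp: awalk_Cons_iff awalk_Nil_iff intro: wellformed')
    with Cons.IH[OF h(3)] have "awalk u (rev (map prod.swap p) @ [(b, v)]) v"
      by (rule awalk_appendI)
    then show ?case using e h by simp
  qed
  have "awalk_cost (\<lambda>_. 1) (rev (map prod.swap p)) = awalk_cost (\<lambda>_. 1) p" for p
    by (simp add: awalk_cost_def o_def sum_list_triv)
  then show ?thesis
    unfolding distance_def \<mu>_def by (intro INF_mono) (metis mem_Collect_eq order_refl rev)
qed

lemma pair_distance_doubleton:
  assumes "pair_sym_digraph G"
  shows "pair_distance (with_proj G) {u, v} = distance (with_proj G) u v"
  unfolding pair_distance_def
  using distance_le_swap[OF assms, of u v] distance_le_swap[OF assms, of v u]
  by (intro the_equality) (auto simp: doubleton_eq_iff)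

end

theory Submission
  imports Defs
begin

text \<open>
  Let \<open>v\<close> be the cut vertex, \<open>m = n - 1\<close>, and call \<open>C \<union> {v}\<close>, for a component \<open>C\<close> of \<open>G - v\<close>, a block.
  Seen from a vertex of a block, every distance level inside the block except the first and the last
  has at least two vertices, for otherwise a vertex other than \<open>v\<close> would cut \<open>G\<close> or \<open>C\<close> would not be
  connected. Hence distances from that vertex sum to at most \<open>s\<^sup>2 div 4\<close> in a block with \<open>s\<close> vertices,
  and equality forces degree two. Since distances between blocks split at \<open>v\<close>, twice the Wiener
  index is at most the sum of \<open>(2 m + 1 - c) ((c + 1)\<^sup>2 div 4)\<close> over the component sizes \<open>c\<close>. These sizes
  add up to \<open>m\<close>, and for \<open>m \<ge> 6\<close> the sum is maximal only for the sizes \<open>m - 1\<close> and \<open>1\<close>; equality then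
  makes the large block a cycle. A Lipschitz function on the lollipop shows that it attains the bound.
\<close>

section \<open>Distances in a relation\<close>

text \<open>Natural numbers keep the counting arguments away from \<open>ereal\<close>. The value is
  meaningful only for reachable pairs, hence the reachability premises below.\<close>

definition rdist :: "'a rel \<Rightarrow> 'a \<Rightarrow> 'a \<Rightarrow> nat" where
  "rdist E u w = (LEAST k. (u, w) \<in> E ^^ k)"

lemma rdist_le: "(u, w) \<in> E ^^ k \<Longrightarrow> rdist E u w \<le> k"
  unfolding rdist_def by (rule Least_le)

lemma rdist_relpow: "(u, w) \<in> E\<^sup>* \<Longrightarrow> (u, w) \<in> E ^^ rdist E u w"
  unfolding rdist_def by (meson LeastI rtrancl_imp_relpow)

lemma rdist_self [simp]: "rdist E u u = 0"
  using rdist_le[where k = 0] by fastforce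

lemma rdist_eq_0_iff: "(u, w) \<in> E\<^sup>* \<Longrightarrow> rdist E u w = 0 \<longleftrightarrow> u = w"
  using rdist_relpow[of u w E] by auto

lemma rdist_eq_1_iff: "(u, w) \<in> E\<^sup>* \<Longrightarrow> u \<noteq> w \<Longrightarrow> rdist E u w = 1 \<longleftrightarrow> (u, w) \<in> E"
  using rdist_relpow[of u w E] rdist_le[where k = 1 and E = E and u = u and w = w] rdist_eq_0_iff[of u w E]
  by (auto simp: le_Suc_eq)

lemma rdist_triangle:
  assumes "(u, x) \<in> E\<^sup>*" "(x, w) \<in> E\<^sup>*"
  shows "rdist E u w \<le> rdist E u x + rdist E x w"
  using assms by (intro rdist_le) (auto simp: relpow_add dest!: rdist_relpow)

lemma rdist_step:
  assumes "(u, x) \<in> E\<^sup>*" "(x, y) \<in> E"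
  shows "rdist E u y \<le> Suc (rdist E u x)"
  using assms by (intro rdist_le) (auto dest!: rdist_relpow)

lemma relpow_sym: "sym E \<Longrightarrow> sym (E ^^ k)"
  by (induction k) (simp_all add: sym_conv_converse_eq converse_relcomp flip: relpow_commute)

lemma rdist_sym: "sym E \<Longrightarrow> rdist E u w = rdist E w u"
  unfolding rdist_def using relpow_sym[of E] by (metis symD)

text \<open>A walk of length \<open>k\<close> raises \<open>f\<close> by at most \<open>k\<close>.
  This bounds distances from below without knowing any shortest path.\<close>

lemma lipschitz_le_rdist:
  assumes "(u, w) \<in> E\<^sup>*" and "\<And>x y. (x, y) \<in> E \<Longrightarrow> f y \<le> Suc (f x)"
  shows "f w \<le> f u + rdist E u w"
proof -
  have "f w \<le> f u + k" if "(u, w) \<in> E ^^ k" for k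
    using that
  proof (induction k arbitrary: w)
    case (Suc k)
    then show ?case using assms(2) by fastforce
  qed simp
  then show ?thesis using rdist_relpow[OF assms(1)] by blast
qed

text \<open>Rising by at most one per step, \<open>f\<close> cannot jump over \<open>t\<close>. The
  point found is reachable inside \<open>S\<close> itself, which matters when \<open>S\<close> is a
  graph with a vertex removed.\<close>

lemma rtrancl_intermediate_value:
  fixes f :: "'a \<Rightarrow> nat"
  assumes "(a, b) \<in> S\<^sup>*" "\<And>x y. (x, y) \<in> S \<Longrightarrow> f y \<le> Suc (f x)" "f a \<le> t" "t \<le> f b"
  shows "\<exists>z. (a, z) \<in> S\<^sup>* \<and> f z = t"
  using assms(1,4)
proof (induction rule: rtrancl_induct)
  case base
  then show ?case using assms(3) by auto
next
  case (step y z)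
  show ?case
  proof (cases "t \<le> f y")
    case False
    then have "f z = t" using assms(2)[OF step.hyps(2)] step.prems by simp
    then show ?thesis using rtrancl.rtrancl_into_rtrancl[OF step.hyps] by blast
  qed (use step in auto)
qed

text \<open>Here \<open>f\<close> stands for the distances from \<open>u\<close>. The number of
  points with value at least \<open>t\<close> drops by two or more at each level before the last, so
  with \<open>k = card K\<close> and largest value \<open>N\<close> the sum is at most
  \<open>N * (k - N)\<close>. A third point on level one makes this strict.\<close>

lemma level_sum:
  fixes f :: "'a \<Rightarrow> nat"
  assumes "finite K" "u \<in> K" "f u = 0"
    and two: "\<And>t w. w \<in> K \<Longrightarrow> 1 \<le> t \<Longrightarrow> t < f w \<Longrightarrow> 2 \<le> card {x \<in> K. f x = t}"
  shows level_sum_le: "sum f K \<le> (card K)\<^sup>2 div 4"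
    and level_sum_eq: "sum f K = (card K)\<^sup>2 div 4 \<Longrightarrow> 4 \<le> card K \<Longrightarrow> card {x \<in> K. f x = 1} = 2"
proof -
  define N where "N = Max (f ` K)"
  define g where "g t = card {w \<in> K. t \<le> f w}" for t
  have le_N: "f w \<le> N" if "w \<in> K" for w
    using assms(1) that unfolding N_def by auto
  obtain w0 where w0: "w0 \<in> K" "f w0 = N"
    using Max_in[of "f ` K"] assms(1,2) unfolding N_def by (metis empty_iff finite_imageI imageE image_is_empty)
  \<comment> \<open>Layer-cake summation: a point is counted once for each \<open>t\<close> from 1
    up to its value.\<close>
  have sum_g: "sum f K = (\<Sum>t=1..N. g t)"
  proof -
    have "f w = (\<Sum>t=1..N. if t \<le> f w then 1 else 0)" if "w \<in> K" for w
    proof -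
      have "{1..N} \<inter> {t. t \<le> f w} = {1..f w}" using le_N[OF that] by auto
      then show ?thesis by (simp add: sum.If_cases)
    qed
    then have "sum f K = (\<Sum>w\<in>K. \<Sum>t=1..N. if t \<le> f w then 1 else 0)" by simp
    also have "\<dots> = (\<Sum>t=1..N. \<Sum>w\<in>K. if t \<le> f w then 1 else 0)" by (rule sum.swap)
    also have "\<dots> = (\<Sum>t=1..N. g t)"
      using assms(1) by (simp add: g_def sum.If_cases Int_def)
    finally show ?thesis .
  qed
  have g_Suc: "g t = g (Suc t) + card {x \<in> K. f x = t}" for t
  proof -
    have "{w \<in> K. t \<le> f w} = {w \<in> K. Suc t \<le> f w} \<union> {x \<in> K. f x = t}" by auto
    then show ?thesis unfolding g_def using assms(1) by (simp add: card_Un_disjoint disjoint_iff)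
  qed
  have g0: "g 0 = card K" by (simp add: g_def)
  have "card {x \<in> K. f x = 0} > 0"
    using assms(1-3) by (auto simp: card_gt_0_iff)
  with g_Suc[of 0] g0 have g1: "g 1 + 1 \<le> card K" by simp
  \<comment> \<open>The point \<open>u\<close> on level zero leaves at most
    \<open>card K - 1\<close> points at \<open>t = 1\<close>; every later level below
    \<open>N\<close> removes at least two more.\<close>
  have g_bound: "g t + 2 * t \<le> card K + 1" if "1 \<le> t" "t \<le> N" for t
    using that
  proof (induction t rule: dec_induct)
    case base
    then show ?case using g1 by simp
  next
    case (step t)
    have "2 \<le> card {x \<in> K. f x = t}" using two[OF w0(1)] w0(2) step by simp
    then show ?case using step g_Suc[of t] by simp
  qed
  have telescope: "(\<Sum>t=1..N. int (card K) + 1 - 2 * int t) = int N * (int (card K) - int N)"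
    by (induction N) (auto simp: algebra_simps)
  have N_le: "int N * (int (card K) - int N) \<le> int ((card K)\<^sup>2 div 4)"
  proof -
    have "0 \<le> (int (card K) - 2 * int N)\<^sup>2" by simp
    then have "4 * (int N * (int (card K) - int N)) \<le> (int (card K))\<^sup>2"
      by (simp add: power2_eq_square algebra_simps)
    then show ?thesis by (simp add: zdiv_int)
  qed
  have sum_le: "int (sum f K) \<le> int N * (int (card K) - int N)"
    unfolding sum_g telescope[symmetric] of_nat_sum
    by (rule sum_mono) (use g_bound in force)
  show "sum f K \<le> (card K)\<^sup>2 div 4" using sum_le N_le by linarith
  show "card {x \<in> K. f x = 1} = 2" if eq: "sum f K = (card K)\<^sup>2 div 4" and "4 \<le> card K"
  proof -
    \<comment> \<open>This rules out \<open>N \<le> 1\<close>, where the sum stays below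
      \<open>card K\<close>.\<close>
    have k4: "card K \<le> (card K)\<^sup>2 div 4"
    proof -
      have "4 * card K \<le> (card K)\<^sup>2" using that(2) by (simp add: power2_eq_square)
      then show ?thesis by linarith
    qed
    have "2 \<le> N"
    proof (rule ccontr)
      assume "\<not> 2 \<le> N"
      then consider "N = 0" | "N = 1" by linarith
      then have "int N * (int (card K) - int N) < int (card K)" using that(2) by cases auto
      then show False using sum_le eq k4 by linarith
    qed
    show ?thesis
    proof (rule ccontr)
      assume ne: "card {x \<in> K. f x = 1} \<noteq> 2"
      have "2 < card {x \<in> K. f x = 1}"
        using ne two[OF w0(1), of 1] w0(2) \<open>2 \<le> N\<close> by simp
      then have "int (g 2) < int (card K) + 1 - 2 * int 2"
        using g_Suc[of 1] g1 by (simp add: numeral_2_eq_2)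
      then have "int (sum f K) < (\<Sum>t=1..N. int (card K) + 1 - 2 * int t)"
        unfolding sum_g of_nat_sum
      proof (intro sum_strict_mono_ex1)
        show "\<exists>t\<in>{1..N}. int (g t) < int (card K) + 1 - 2 * int t"
          using \<open>2 \<le> N\<close> \<open>int (g 2) < _\<close> by (intro bexI[of _ 2]) auto
      qed (use g_bound in force)+
      then show False using eq N_le telescope by simp
    qed
  qed
qed

section \<open>Extremal block sizes\<close>

text \<open>Bound for the share of a component of size \<open>c\<close> in a graph on
  \<open>m + 1\<close> vertices. With \<open>q = (c + 1)\<^sup>2 div 4\<close>, each of its
  \<open>c\<close> rows gives at most \<open>q\<close> inside the block, and the row of
  \<open>v\<close> inside the block counts \<open>2 * m + 1 - 2 * c\<close> times.\<close>

definition block_weight :: "nat \<Rightarrow> nat \<Rightarrow> int" where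
  "block_weight m c = (2 * int m + 1 - int c) * int ((c + 1)\<^sup>2 div 4)"

text \<open>A square is 0 or 1 modulo 4, so the floor loses at most a quarter. Below, these bounds
  replace floors by polynomials.\<close>

lemma square_div_4_bounds:
  "4 * int (s\<^sup>2 div 4) \<le> (int s)\<^sup>2" "(int s)\<^sup>2 \<le> 4 * int (s\<^sup>2 div 4) + 1"
proof -
  have "s\<^sup>2 mod 4 \<le> 1"
  proof (cases "even s")
    case True
    then show ?thesis by (auto elim!: evenE simp: power2_eq_square)
  next
    case False
    then obtain k where "s = 2 * k + 1" by (elim oddE)
    then have "s\<^sup>2 = 4 * (k\<^sup>2 + k) + 1" by (simp add: power2_eq_square algebra_simps)
    then show ?thesis by (metis mod_mult_self4 le_refl mod_less_eq_dividend)
  qed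
  moreover have "s\<^sup>2 = 4 * (s\<^sup>2 div 4) + s\<^sup>2 mod 4" by simp
  ultimately have "4 * (s\<^sup>2 div 4) \<le> s\<^sup>2" "s\<^sup>2 \<le> 4 * (s\<^sup>2 div 4) + 1" by linarith+
  from this[THEN of_nat_mono[where 'a = int]]
  show "4 * int (s\<^sup>2 div 4) \<le> (int s)\<^sup>2" "(int s)\<^sup>2 \<le> 4 * int (s\<^sup>2 div 4) + 1"
    by (simp_all del: of_nat_div)
qed

text \<open>
  \<open>block_weight m\<close> fails to be superadditive only at \<open>1 + 1 = 2\<close>: two pendant vertices contribute
  \<open>4 m\<close>, a triangle \<open>4 m - 2\<close>. The correction at \<open>2\<close> repairs this.
\<close>

definition block_cap :: "nat \<Rightarrow> nat \<Rightarrow> int" where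
  "block_cap m c = block_weight m c + (if c = 2 then 2 else 0)"

lemma block_weight_small: "block_weight m (Suc 0) = 2 * int m" "block_weight m 2 = 4 * int m - 2"
    "block_weight m 3 = 8 * int m - 8" "block_weight m 4 = 12 * int m - 18"
  by (simp_all add: block_weight_def power2_eq_square)

lemma four_block_weight_le: "c \<le> m \<Longrightarrow> 4 * block_weight m c \<le> (2 * int m + 1 - int c) * (int c + 1)\<^sup>2"
  using mult_left_mono[OF square_div_4_bounds(1)[of "c + 1"], of "2 * int m + 1 - int c"]
  by (simp add: block_weight_def algebra_simps)

lemma four_block_weight_ge: "c \<le> m \<Longrightarrow>
    (2 * int m + 1 - int c) * ((int c + 1)\<^sup>2 - 1) \<le> 4 * block_weight m c"
proof -
  assume "c \<le> m"
  have "(int c + 1)\<^sup>2 - 1 \<le> 4 * int ((c + 1)\<^sup>2 div 4)"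
    using square_div_4_bounds(2)[of "c + 1"] by (simp add: add.commute)
  then have "(2 * int m + 1 - int c) * ((int c + 1)\<^sup>2 - 1) \<le> (2 * int m + 1 - int c) * (4 * int ((c + 1)\<^sup>2 div 4))"
    using \<open>c \<le> m\<close> by (intro mult_left_mono) auto
  then show ?thesis by (simp add: block_weight_def algebra_simps)
qed

text \<open>Pairs with \<open>a * b \<le> 2\<close> and the pair \<open>2, 2\<close> are computed.
  Otherwise, four times the difference of the weights is at least \<open>(M - (2 * (x + y) + 3)) *
  (2 * (x * y) - 2) + (x * y - 3) * (x + y + 2)\<close>; the first product is nonnegative because
  \<open>a + b < m\<close>.\<close>

lemma block_cap_superadditive:
  assumes "6 \<le> m" "1 \<le> a" "1 \<le> b" "a + b < m"
  shows "block_cap m a + block_cap m b \<le> block_cap m (a + b)"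
proof -
  have small: ?thesis if "a * b \<le> 2"
  proof -
    have "a = 1 \<and> b = 1 \<or> a = 1 \<and> b = 2 \<or> a = 2 \<and> b = 1"
    proof -
      have "a \<le> 2" "b \<le> 2" using that assms(2,3)
        by (metis le_trans mult_le_mono2 mult.right_neutral, metis le_trans mult_le_mono1 mult_1)
      then show ?thesis using that assms(2,3) by (cases "a = 2"; cases "b = 2") auto
    qed
    then show ?thesis using assms(1) by (auto simp: block_cap_def block_weight_small numeral_2_eq_2[symmetric] numeral_3_eq_3[symmetric])
  qed
  have mid: ?thesis if "a = 2" "b = 2"
    using that assms(1) by (simp add: block_cap_def block_weight_small)
  have big: ?thesis if "3 \<le> a * b" "\<not> (a = 2 \<and> b = 2)"
  proof -
    define x y M where "x = int a" "y = int b" "M = 2 * int m + 1"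
    have xy: "1 \<le> x" "1 \<le> y" "2 * (x + y) + 3 \<le> M" "3 \<le> x * y"
      using assms that(1) by (auto simp: x_y_M_def simp flip: of_nat_mult)
    \<comment> \<open>Four times the correction 2 in \<open>block_cap\<close>. It occurs for at most
      one summand, as \<open>a = b = 2\<close> is excluded.\<close>
    define e :: int where "e = (if a = 2 \<or> b = 2 then 8 else 0)"
    have slack: "e \<le> (x * y - 3) * (x + y + 2)"
    proof (cases "a = 2 \<or> b = 2")
      case True
      then have "3 \<le> a \<or> 3 \<le> b"
        using that assms(2,3) by (cases "a = 1"; cases "b = 1") auto
      then have "6 \<le> x * y \<and> 5 \<le> x + y"
        using True unfolding x_y_M_def by auto
      then have "3 * 7 \<le> (x * y - 3) * (x + y + 2)" by (intro mult_mono) auto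
      then show ?thesis using True by (simp add: e_def)
    qed (use xy in \<open>simp add: e_def\<close>)
    have "(2 * (x + y) + 3) * (2 * (x * y) - 2) \<le> M * (2 * (x * y) - 2)"
      using xy by (intro mult_right_mono) auto
    moreover have "(M - (x + y)) * ((x + y + 1)\<^sup>2 - 1) - (M - x) * (x + 1)\<^sup>2 - (M - y) * (y + 1)\<^sup>2
      = M * (2 * (x * y) - 2) - (2 * (x + y) + 3) * (2 * (x * y) - 2) + (x * y - 3) * (x + y + 2)"
      by (simp add: power2_eq_square algebra_simps)
    ultimately have key: "(M - x) * (x + 1)\<^sup>2 + (M - y) * (y + 1)\<^sup>2 + e
        \<le> (M - (x + y)) * ((x + y + 1)\<^sup>2 - 1)"
      using slack by linarith
    have "4 * block_weight m a \<le> (M - x) * (x + 1)\<^sup>2" "4 * block_weight m b \<le> (M - y) * (y + 1)\<^sup>2"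
      "(M - (x + y)) * ((x + y + 1)\<^sup>2 - 1) \<le> 4 * block_weight m (a + b)"
      using four_block_weight_le[of a m] four_block_weight_le[of b m] four_block_weight_ge[of "a + b" m]
        assms(4) by (auto simp: x_y_M_def)
    with key have "4 * block_weight m a + 4 * block_weight m b + e \<le> 4 * block_weight m (a + b)" by linarith
    then show ?thesis using that(2) assms unfolding block_cap_def e_def by auto
  qed
  show ?thesis using small mid big by linarith
qed

text \<open>The right-hand side is the total weight for the sizes \<open>m - 1\<close> and 1, so
  every other split into two parts is strictly worse.\<close>

lemma block_cap_pair:
  assumes "6 \<le> m" "2 \<le> a" "2 \<le> b" "a + b = m"
  shows "block_cap m a + block_cap m b < 2 * int m + (int m + 2) * int (m\<^sup>2 div 4)"
proof -
  have aux: "block_cap m a + block_cap m b < 2 * int m + (int m + 2) * int (m\<^sup>2 div 4)" if "a \<le> b" "2 \<le> a" "a + b = m" for a b :: nat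
  \<comment> \<open>For sizes 2 and 4 the polynomial estimate leaves only 4, less than the
    correction 8, so the values are computed.\<close>
  proof (cases "m = 6 \<and> a = 2")
    case True
    then have "m = 6" "a = 2" "b = 4" using that by auto
    then show ?thesis by (simp add: block_cap_def block_weight_def)
  next
    case False
    define x y z where "x = int a" "y = int b" "z = int m"
    have xyz: "z = x + y" "2 \<le> x" "x \<le> y" "6 \<le> z" 
      using that assms(1) by (auto simp: x_y_z_def)
    \<comment> \<open>The right side bounds from below four times the gap for
      \<open>block_weight\<close>; 8 is four times the correction at \<open>a = 2\<close>.\<close>
    have "(if a = 2 then 8 else 0) < x * y * (z - 2) - (z\<^sup>2 - 2 * z + 4)"
    proof (cases "a = 2")
      case True
      then have z: "7 \<le> z" and xy: "x = 2" "y = z - 2" using False xyz assms(1) by (auto simp: x_y_z_def)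
      have "0 \<le> (z - 7) * (z + 1)" using z by auto
      then show ?thesis unfolding xy using True by (simp add: power2_eq_square algebra_simps)
    next
      case a: False
      then have "3 \<le> x" using xyz by (auto simp: x_y_z_def)
      \<comment> \<open>For a fixed sum \<open>z\<close> the product \<open>x * y\<close> is
        smallest at \<open>x = 3\<close>.\<close>
      then have "0 \<le> (x - 3) * (y - 3)" using xyz by simp
      then have "3 * (z - 3) \<le> x * y" using xyz by (simp add: algebra_simps)
      then have "3 * (z - 3) * (z - 2) \<le> x * y * (z - 2)" using xyz by (intro mult_right_mono) auto
      moreover have "0 < 3 * (z - 3) * (z - 2) - (z\<^sup>2 - 2 * z + 4)"
      proof -
        have "0 \<le> (z - 6) * (2 * z - 1)" using xyz by (intro mult_nonneg_nonneg) auto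
        then show ?thesis by (simp add: power2_eq_square algebra_simps)
      qed
      ultimately show ?thesis using a by simp
    qed
    moreover have "(z + 2) * (z\<^sup>2 - 1) + 8 * z - (2 * z + 1 - x) * (x + 1)\<^sup>2 - (2 * z + 1 - y) * (y + 1)\<^sup>2
        = x * y * (z - 2) - (z\<^sup>2 - 2 * z + 4)"
      unfolding xyz(1) by (simp add: power2_eq_square algebra_simps)
    moreover have "4 * block_weight m a \<le> (2 * z + 1 - x) * (x + 1)\<^sup>2"
      "4 * block_weight m b \<le> (2 * z + 1 - y) * (y + 1)\<^sup>2"
      using four_block_weight_le[of a m] four_block_weight_le[of b m] that by (auto simp: x_y_z_def)
    moreover have "(z + 2) * (z\<^sup>2 - 1) \<le> (z + 2) * (4 * int (m\<^sup>2 div 4))"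
      using square_div_4_bounds(2)[of m] xyz by (intro mult_left_mono) (auto simp: x_y_z_def)
    moreover have "b \<noteq> 2" using that assms(1) by auto
    ultimately have "4 * block_cap m a + 4 * block_cap m b < 8 * z + (z + 2) * (4 * int (m\<^sup>2 div 4))"
      by (auto simp: block_cap_def split: if_splits)
    then show ?thesis unfolding x_y_z_def by (simp add: algebra_simps)
  qed
  show ?thesis using aux[of a b] aux[of b a] assms by (cases "a \<le> b") (auto simp: add.commute)
qed

text \<open>Components are merged one at a time; all partial sums stay below \<open>m\<close>, as
  superadditivity requires.\<close>

lemma block_cap_sum:
  assumes "6 \<le> m" "finite I" "I \<noteq> {}" "\<And>i. i \<in> I \<Longrightarrow> 1 \<le> s i" "sum s I < m"
  shows "(\<Sum>i\<in>I. block_cap m (s i)) \<le> block_cap m (sum s I)"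
  using assms(2-5)
proof (induction rule: finite_ne_induct)
  case (insert i I)
  have "1 \<le> sum s I"
    using insert by (metis ex_in_conv insert_iff le_trans member_le_sum zero_le)
  then have "block_cap m (s i) + block_cap m (sum s I) \<le> block_cap m (s i + sum s I)"
    using insert assms(1) by (intro block_cap_superadditive) auto
  then show ?case using insert by simp
qed simp

text \<open>Fix one component and merge all the others, which leaves two sizes with sum
  \<open>m\<close>. Unless some size is \<open>m - 1\<close>, a component of size other than 1 can
  be fixed, and then both parts have at least two vertices and \<open>block_cap_pair\<close> is
  strict. If all sizes are 1, the sum is computed.\<close>

lemma block_weight_extremal:
  assumes "6 \<le> m" "finite I" "2 \<le> card I" "\<And>i. i \<in> I \<Longrightarrow> 1 \<le> s i" "sum s I = m"
  defines "T \<equiv> 2 * int m + (int m + 2) * int (m\<^sup>2 div 4)"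
  shows block_weight_sum_le: "(\<Sum>i\<in>I. block_weight m (s i)) \<le> T"
    and block_weight_sum_eq: "(\<Sum>i\<in>I. block_weight m (s i)) = T \<Longrightarrow> \<exists>i j. I = {i, j} \<and> i \<noteq> j \<and> s i = m - 1 \<and> s j = 1"
proof -
  let ?S = "\<Sum>i\<in>I. block_weight m (s i)"
  have rest: "1 \<le> sum s (I - {i})" "s i + sum s (I - {i}) = m" "I - {i} \<noteq> {}" if "i \<in> I" for i
  proof -
    show ne: "I - {i} \<noteq> {}" using assms(2,3) that card_mono[of "{i}" I] by auto
    then obtain j where "j \<in> I - {i}" by blast
    then show "1 \<le> sum s (I - {i})" using assms(2,4)
      by (meson DiffD1 finite_Diff le_trans member_le_sum zero_le)
    show "s i + sum s (I - {i}) = m" using assms(2,5) that by (simp add: sum.remove)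
  qed
  have le: "?S \<le> block_cap m (s i) + block_cap m (sum s (I - {i}))" if "i \<in> I" for i
  proof -
    have "?S \<le> (\<Sum>i\<in>I. block_cap m (s i))" by (rule sum_mono) (simp add: block_cap_def)
    also have "\<dots> = block_cap m (s i) + (\<Sum>i\<in>I - {i}. block_cap m (s i))"
      using assms(2) that by (simp add: sum.remove)
    also have "\<dots> \<le> block_cap m (s i) + block_cap m (sum s (I - {i}))"
    proof -
      have "sum s (I - {i}) < m" using rest(2)[OF that] assms(4)[OF that] by linarith
      then show ?thesis
        using block_cap_sum[OF assms(1) _ rest(3)[OF that], of s] assms(2,4) by simp
    qed
    finally show ?thesis .
  qed
  have T: "block_weight m (m - 1) + block_weight m 1 = T"
    using assms(1) by (simp add: block_weight_def T_def of_nat_diff power2_eq_square)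
  have strict: "?S < T" if "\<not> (\<exists>i\<in>I. s i = m - 1)"
  proof (cases "\<forall>i\<in>I. s i = 1")
    \<comment> \<open>Merging would lead to the sizes 1 and \<open>m - 1\<close> and so give only
      the bound \<open>T\<close>. The exact value \<open>2 * m * m\<close> is strictly below
      \<open>T\<close>.\<close>
    case True
    then have "card I = m" using assms(5) by simp
    then have "?S = int m * (2 * int m)" using True by (simp add: block_weight_small)
    moreover have "int m * (2 * int m) < T"
    proof -
      have "(int m + 2) * ((int m)\<^sup>2 - 1) \<le> (int m + 2) * (4 * int (m\<^sup>2 div 4))"
        using square_div_4_bounds(2)[of m] by (intro mult_left_mono) auto
      moreover have "0 \<le> (int m - 6) * (int m)\<^sup>2" using assms(1) by (intro mult_nonneg_nonneg) auto
      moreover have "(int m + 2) * ((int m)\<^sup>2 - 1) + 8 * int m - 4 * (int m * (2 * int m))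
          = (int m - 6) * (int m)\<^sup>2 + 7 * int m - 2"
        by (simp add: power2_eq_square algebra_simps)
      moreover have "(int m + 2) * (4 * int (m\<^sup>2 div 4)) = 4 * ((int m + 2) * int (m\<^sup>2 div 4))"
        by (rule mult.left_commute)
      ultimately show ?thesis using assms(1) unfolding T_def by linarith
    qed
    ultimately show ?thesis by simp
  next
    case False
    then obtain i where i: "i \<in> I" "s i \<noteq> 1" by blast
    have "s i \<noteq> m - 1" using that i(1) by blast
    then have "2 \<le> s i" "2 \<le> sum s (I - {i})"
      using i(2) assms(4)[OF i(1)] rest(1,2)[OF i(1)] by linarith+
    then show ?thesis using block_cap_pair[of m "s i" "sum s (I - {i})"] le[OF i(1)] rest[OF i(1)] assms(1)
      unfolding T_def by linarith
  qed
  have big: "sum s (I - {i}) = 1" if "i \<in> I" "s i = m - 1" for i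
    using rest[OF that(1)] that assms(1) by auto
  show "?S \<le> T"
  proof (cases "\<exists>i\<in>I. s i = m - 1")
    case True
    then obtain i where i: "i \<in> I" "s i = m - 1" by blast
    then show ?thesis using le[OF i(1)] big[OF i] T assms(1)
      by (simp add: block_cap_def split: if_splits)
  qed (use strict in simp)
  show "\<exists>i j. I = {i, j} \<and> i \<noteq> j \<and> s i = m - 1 \<and> s j = 1" if "?S = T"
  proof -
    have "\<exists>i\<in>I. s i = m - 1" using strict \<open>?S = T\<close> by (metis order_less_irrefl)
    then obtain i where i: "i \<in> I" "s i = m - 1" by blast
    have "card (I - {i}) \<le> sum s (I - {i})"
      using sum_mono[of "I - {i}" "\<lambda>_. 1" s] assms(4) by simp
    then have "card (I - {i}) = 1" using big[OF i] assms(3) card_Diff_singleton[OF i(1)] by linarith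
    then obtain j where j: "I - {i} = {j}" by (rule card_1_singletonE)
    have "s j = 1" using big[OF i] unfolding j by simp
    moreover have "I = {i, j}" "i \<noteq> j" using j i(1) by blast+
    ultimately show ?thesis using i(2) by blast
  qed
qed

section \<open>Graphs with a single cut vertex\<close>

text \<open>The situation in terms of a plain relation. Vertices other than \<open>v\<close> do not
  cut; that \<open>v\<close> does enters later as \<open>2 \<le> card comps\<close>.\<close>

locale one_cut_graph =
  fixes V :: "'a set" and E :: "'a rel" and v :: 'a
  assumes finite_V: "finite V" and E_subset: "E \<subseteq> V \<times> V" and sym_E: "sym E"
    and irrefl_E: "irrefl E"
    and connected_E: "u \<in> V \<Longrightarrow> w \<in> V \<Longrightarrow> (u, w) \<in> E\<^sup>*"
    and v_in_V: "v \<in> V"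
    and connected_del: "x \<in> V \<Longrightarrow> x \<noteq> v \<Longrightarrow> u \<in> V - {x} \<Longrightarrow> w \<in> V - {x} \<Longrightarrow>
      (u, w) \<in> (Restr E (V - {x}))\<^sup>*"
begin

abbreviation "d \<equiv> rdist E"

definition R :: "'a rel" where "R = Restr E (V - {v})"

definition comp :: "'a \<Rightarrow> 'a set" where "comp u = R\<^sup>* `` {u}"

definition comps :: "'a set set" where "comps = comp ` (V - {v})"

lemma sym_R: "sym (R\<^sup>*)"
  using sym_E by (intro sym_rtrancl) (auto simp: R_def sym_def)

lemma d_commute: "d u w = d w u"
  by (rule rdist_sym[OF sym_E])

lemma d_triangle: "u \<in> V \<Longrightarrow> x \<in> V \<Longrightarrow> w \<in> V \<Longrightarrow> d u w \<le> d u x + d x w"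
  by (intro rdist_triangle connected_E)

lemma comp_self: "u \<in> comp u"
  by (simp add: comp_def)

lemma comp_subset: "u \<in> V - {v} \<Longrightarrow> comp u \<subseteq> V - {v}"
proof
  fix w assume u: "u \<in> V - {v}" and "w \<in> comp u"
  then have "(u, w) \<in> R\<^sup>*" by (simp add: comp_def)
  then show "w \<in> V - {v}" using u by (induction rule: rtrancl_induct) (auto simp: R_def)
qed

lemma comp_eq: "w \<in> comp u \<Longrightarrow> comp w = comp u"
  unfolding comp_def using sym_R by (auto dest: symD intro: rtrancl_trans)

lemma comp_closed:
  assumes "u \<in> V - {v}" "x \<in> comp u" "(x, y) \<in> E" "y \<noteq> v"
  shows "y \<in> comp u"
proof -
  have "(x, y) \<in> R" using assms comp_subset[OF assms(1)] E_subset by (auto simp: R_def)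
  then show ?thesis using assms(2) by (auto simp: comp_def intro: rtrancl_into_rtrancl)
qed

lemma finite_comps: "finite comps"
  unfolding comps_def using finite_V by simp

lemma comps_subset: "C \<in> comps \<Longrightarrow> C \<subseteq> V - {v}"
  unfolding comps_def using comp_subset by blast

lemma finite_comp: "C \<in> comps \<Longrightarrow> finite C"
  using comps_subset finite_V by (meson finite_Diff finite_subset)

lemma comps_nonempty: "C \<in> comps \<Longrightarrow> C \<noteq> {}"
  unfolding comps_def using comp_self by blast

lemma comps_disjoint: "C \<in> comps \<Longrightarrow> D \<in> comps \<Longrightarrow> C \<noteq> D \<Longrightarrow> C \<inter> D = {}"
  unfolding comps_def using comp_eq by (metis (no_types, lifting) disjoint_iff imageE)

lemma comps_Union: "\<Union>comps = V - {v}"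
  unfolding comps_def using comp_subset comp_self by blast

lemma sum_comps: "(\<Sum>u\<in>V - {v}. f u) = (\<Sum>C\<in>comps. \<Sum>u\<in>C. f u)"
  unfolding comps_Union[symmetric]
  using sum.Union_disjoint[of comps f] finite_comp comps_disjoint by auto

text \<open>If \<open>x\<close> were alone on its level, a walk from \<open>u\<close> to
  \<open>w\<close> avoiding \<open>x\<close> would exist: inside \<open>C\<close> if
  \<open>x = v\<close>, and otherwise because \<open>x\<close> is not a cut vertex. Distances change
  by at most one per step, so that walk would still have to meet level \<open>t\<close>.\<close>

lemma two_at_each_level:
  assumes "C \<in> comps" "u \<in> insert v C" "w \<in> insert v C" "1 \<le> t" "t < d u w"
  shows "2 \<le> card {x \<in> insert v C. d u x = t}"
proof -
  obtain c where c: "c \<in> V - {v}" "C = comp c" using assms(1) by (auto simp: comps_def)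
  define K where "K = insert v C"
  have K: "K \<subseteq> V" "finite K" "u \<in> K" "w \<in> K" "v \<in> K"
    using comps_subset[OF assms(1)] v_in_V finite_comp[OF assms(1)] assms(2,3) by (auto simp: K_def)
  \<comment> \<open>Retraction of the graph onto the block. Edges leave the block only at
    \<open>v\<close>, so an edge is either kept or collapsed; walks may therefore wander outside the
    block.\<close>
  define r where "r y = (if y \<in> K then y else v)" for y
  have rK: "r y \<in> K" for y using K(5) by (simp add: r_def)
  have lip: "d u (r y) \<le> Suc (d u (r x))" if "(x, y) \<in> E" for x y
  proof -
    have "(y, x) \<in> E" using that sym_E by (auto dest: symD)
    then have "r x = r y \<or> (x \<in> K \<and> y \<in> K)"
      using that comp_closed[OF c(1)] c(2) unfolding r_def K_def by auto
    then show ?thesis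
    proof
      assume "x \<in> K \<and> y \<in> K"
      then show ?thesis using that K connected_E[of u x] by (auto simp: r_def intro!: rdist_step)
    qed simp
  qed
  have ends: "d u (r u) \<le> t" "t \<le> d u (r w)" using K assms(5) by (auto simp: r_def)
  have "(u, w) \<in> E\<^sup>*" using K connected_E by blast
  from rtrancl_intermediate_value[OF this, of "\<lambda>y. d u (r y)", OF lip ends]
  obtain x where x: "x \<in> K" "d u x = t" using rK by blast
  have "\<exists>y\<in>K. y \<noteq> x \<and> d u y = t"
  proof (rule ccontr)
    assume unique: "\<not> ?thesis"
    have ux: "u \<noteq> x" "w \<noteq> x" using x assms(4,5) by auto
    have "(u, w) \<in> (Restr E (V - {x}))\<^sup>*"
    proof (cases "x = v")
      case True
      then have "(c, u) \<in> R\<^sup>*" "(c, w) \<in> R\<^sup>*" using ux K c by (auto simp: K_def comp_def)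
      then have "(u, w) \<in> R\<^sup>*" using sym_R by (meson rtrancl_trans symD)
      then show ?thesis using True by (simp add: R_def)
    next
      case False
      then show ?thesis using connected_del[of x u w] x K ux by blast
    qed
    then obtain z where z: "(u, z) \<in> (Restr E (V - {x}))\<^sup>*" "d u (r z) = t"
      using rtrancl_intermediate_value[of u w "Restr E (V - {x})" "\<lambda>y. d u (r y)", OF _ _ ends] lip by blast
    \<comment> \<open>The walk avoids \<open>x\<close> but its retraction hits it, so
      \<open>z\<close> lies outside the block and \<open>x = v\<close>. A walk avoiding
      \<open>v\<close> cannot leave \<open>C\<close>, however.\<close>
    have "z \<noteq> x" using z(1) ux by (auto elim: rtranclE)
    have "r z = x" using z(2) unique rK by blast
    with \<open>z \<noteq> x\<close> have "z \<notin> K" "x = v" by (auto simp: r_def split: if_splits)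
    then have "(u, z) \<in> R\<^sup>*" "u \<in> C" using z(1) ux K by (auto simp: R_def K_def)
    then have "z \<in> C" using c by (auto simp: comp_def)
    then show False using \<open>z \<notin> K\<close> by (simp add: K_def)
  qed
  then obtain y where "y \<in> K" "y \<noteq> x" "d u y = t" by blast
  then have "card {x, y} \<le> card {x \<in> K. d u x = t}" using x K(2) by (intro card_mono) auto
  then show ?thesis using \<open>y \<noteq> x\<close> by (simp add: K_def)
qed

lemma card_block: "C \<in> comps \<Longrightarrow> card (insert v C) = card C + 1"
  using comps_subset finite_comp by (subst card_insert_disjoint) auto

lemma block_transmission_le:
  assumes "C \<in> comps" "u \<in> insert v C"
  shows "(\<Sum>w\<in>insert v C. d u w) \<le> (card C + 1)\<^sup>2 div 4"
  using level_sum_le[of "insert v C" u "d u"] finite_comp[OF assms(1)] assms(2)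
    two_at_each_level[OF assms] card_block[OF assms(1)] by simp

text \<open>Level one is the neighbourhood inside the block, so the equality case of
  \<open>level_sum\<close> fixes the degree.\<close>

lemma block_degree_eq_2:
  assumes "C \<in> comps" "u \<in> insert v C" "3 \<le> card C"
    and "(\<Sum>w\<in>insert v C. d u w) = (card C + 1)\<^sup>2 div 4"
  shows "card {x \<in> insert v C. (u, x) \<in> E} = 2"
proof -
  have "card {x \<in> insert v C. d u x = 1} = 2"
    using level_sum_eq[of "insert v C" u "d u"] finite_comp[OF assms(1)] assms
      two_at_each_level[OF assms(1,2)] card_block[OF assms(1)] by simp
  moreover have "d u x = 1 \<longleftrightarrow> (u, x) \<in> E" if "x \<in> insert v C" for x
  proof (cases "u = x")
    case True
    then show ?thesis using irrefl_E by (auto simp: irrefl_def)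
  next
    case False
    then show ?thesis using rdist_eq_1_iff[of u x E] connected_E[of u x] that assms(2)
        comps_subset[OF assms(1)] v_in_V by blast
  qed
  then have "{x \<in> insert v C. d u x = 1} = {x \<in> insert v C. (u, x) \<in> E}" by blast
  ultimately show ?thesis by simp
qed

section \<open>Splitting the distance sum at \<open>v\<close>\<close>

definition block_sum :: "'a set \<Rightarrow> nat" where
  "block_sum C = (\<Sum>u\<in>C. \<Sum>w\<in>insert v C. d u w)"

text \<open>The row of \<open>v\<close> is kept apart from \<open>block_sum\<close>:
  \<open>v\<close> lies in every block, and distances between blocks are measured through
  it.\<close>

definition hub_sum :: "'a set \<Rightarrow> nat" where
  "hub_sum C = (\<Sum>w\<in>insert v C. d v w)"

abbreviation "m \<equiv> card V - 1"

lemma card_V_minus_v: "card (V - {v}) = m"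
  using v_in_V by simp

lemma card_comp_le: "C \<in> comps \<Longrightarrow> card C \<le> m"
  using comps_subset finite_V card_V_minus_v by (metis card_mono finite_Diff)

lemma sum_card_comps: "sum card comps = m"
  using sum_comps[of "\<lambda>_. 1::nat"] card_V_minus_v by simp

text \<open>
  Every path between different components passes through \<open>v\<close>, so the ordered distance sum splits
  into contributions of the blocks. Only the triangle inequality is needed for the upper bound.
\<close>

lemma total_distance_le_sum:
  "int (\<Sum>u\<in>V. \<Sum>w\<in>V. d u w)
    \<le> (\<Sum>C\<in>comps. int (block_sum C) + (2 * int m + 1 - 2 * int (card C)) * int (hub_sum C))"
proof -
  define g where "g u w = int (d u w)" for u w
  define H where "H C = int (hub_sum C)" for C
  have H: "H C = (\<Sum>w\<in>C. g v w)" if "C \<in> comps" for C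
    using comps_subset[OF that] finite_comp[OF that] unfolding H_def hub_sum_def g_def
    by (subst sum.insert) auto
  define D where "D = (\<Sum>w\<in>V - {v}. g v w)"
  have D: "D = (\<Sum>C\<in>comps. H C)" unfolding D_def sum_comps using H by simp
  have split_v: "(\<Sum>w\<in>V. f w) = f v + (\<Sum>w\<in>V - {v}. f w)" for f :: "'a \<Rightarrow> int"
    using v_in_V finite_V by (simp add: sum.remove)
  \<comment> \<open>Each of the \<open>m - card C\<close> vertices outside the block is reached
    through \<open>v\<close>, at cost at most \<open>g v u + g v w\<close>.\<close>
  have row: "(\<Sum>w\<in>V. g u w) \<le> (\<Sum>w\<in>insert v C. g u w) + (int m - int (card C)) * g v u + (D - H C)"
    if C: "C \<in> comps" and u: "u \<in> C" for C u
  proof -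
    have sub: "C \<subseteq> V - {v}" "finite C" using comps_subset finite_comp C by auto
    have "(\<Sum>w\<in>V. g u w) = g u v + (\<Sum>w\<in>V - {v}. g u w)" by (rule split_v)
    also have "(\<Sum>w\<in>V - {v}. g u w) = (\<Sum>w\<in>C. g u w) + (\<Sum>w\<in>V - {v} - C. g u w)"
      using sub finite_V by (simp add: sum.subset_diff)
    also have "(\<Sum>w\<in>V - {v} - C. g u w) \<le> (\<Sum>w\<in>V - {v} - C. g v u + g v w)"
    proof (rule sum_mono)
      fix w assume "w \<in> V - {v} - C"
      then show "g u w \<le> g v u + g v w"
        using d_triangle[of u v w] sub u v_in_V d_commute[of u v] by (auto simp: g_def)
    qed
    also have "\<dots> = int (card (V - {v} - C)) * g v u + (\<Sum>w\<in>V - {v} - C. g v w)"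
      by (simp add: sum.distrib)
    also have "(\<Sum>w\<in>V - {v} - C. g v w) = D - H C"
      unfolding D_def H[OF C] using sub finite_V by (simp add: sum_diff)
    also have "int (card (V - {v} - C)) = int m - int (card C)"
      using sub finite_V card_comp_le[OF C] by (simp add: card_Diff_subset v_in_V of_nat_diff)
    finally show ?thesis using sub by (subst sum.insert) auto
  qed
  have "(\<Sum>u\<in>V. \<Sum>w\<in>V. g u w) = D + (\<Sum>C\<in>comps. \<Sum>u\<in>C. \<Sum>w\<in>V. g u w)"
    by (subst split_v) (simp add: sum_comps[symmetric] split_v[of "g v"] D_def, simp add: g_def)
  also have "\<dots> \<le> D + (\<Sum>C\<in>comps. int (block_sum C) + (int m - int (card C)) * H C + int (card C) * (D - H C))"
  proof (intro add_left_mono sum_mono)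
    fix C assume C: "C \<in> comps"
    have "(\<Sum>u\<in>C. \<Sum>w\<in>V. g u w)
        \<le> (\<Sum>u\<in>C. (\<Sum>w\<in>insert v C. g u w) + (int m - int (card C)) * g v u + (D - H C))"
      by (rule sum_mono) (rule row[OF C])
    also have "\<dots> = int (block_sum C) + (int m - int (card C)) * H C + int (card C) * (D - H C)"
      by (simp add: sum.distrib H[OF C] sum_distrib_left block_sum_def g_def)
    finally show "(\<Sum>u\<in>C. \<Sum>w\<in>V. g u w)
        \<le> int (block_sum C) + (int m - int (card C)) * H C + int (card C) * (D - H C)" .
  qed
  \<comment> \<open>The sizes add up to \<open>m\<close>, so the terms with \<open>D\<close> amount
    to \<open>m * D\<close>. Together with the row of \<open>v\<close>, the coefficient of
    \<open>H C\<close> becomes \<open>1 + m + (m - 2 * card C)\<close>.\<close>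
  also have "\<dots> = (\<Sum>C\<in>comps. H C) + (int m * (\<Sum>C\<in>comps. H C)
      + (\<Sum>C\<in>comps. int (block_sum C) + (int m - 2 * int (card C)) * H C))"
  proof -
    have "(\<Sum>C\<in>comps. int (block_sum C) + (int m - int (card C)) * H C + int (card C) * (D - H C))
      = (\<Sum>C\<in>comps. int (card C) * D + (int (block_sum C) + (int m - 2 * int (card C)) * H C))"
      by (intro sum.cong refl) (simp add: algebra_simps)
    also have "\<dots> = int m * D + (\<Sum>C\<in>comps. int (block_sum C) + (int m - 2 * int (card C)) * H C)"
      unfolding sum.distrib[of "\<lambda>C. int (card C) * D"] sum_distrib_right[symmetric]
        of_nat_sum[symmetric] sum_card_comps ..
    finally show ?thesis by (simp only: D)
  qed
  also have "\<dots> = (\<Sum>C\<in>comps. H C + (int m * H C + (int (block_sum C) + (int m - 2 * int (card C)) * H C)))"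
    unfolding sum_distrib_left sum.distrib[symmetric] ..
  also have "\<dots> = (\<Sum>C\<in>comps. int (block_sum C) + (2 * int m + 1 - 2 * int (card C)) * H C)"
    by (intro sum.cong refl) (simp add: algebra_simps)
  finally show ?thesis by (simp add: g_def H_def)
qed

text \<open>Every row inside the block is at most \<open>(card C + 1)\<^sup>2 div 4\<close>, and
  \<open>card C \<le> m\<close> keeps the coefficient of \<open>hub_sum\<close> positive.\<close>

lemma block_bounds:
  assumes "C \<in> comps"
  shows block_sum_le: "block_sum C \<le> card C * ((card C + 1)\<^sup>2 div 4)"
    and hub_sum_le: "hub_sum C \<le> (card C + 1)\<^sup>2 div 4"
    and block_total_le: "int (block_sum C) + (2 * int m + 1 - 2 * int (card C)) * int (hub_sum C)
      \<le> block_weight m (card C)"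
proof -
  show b: "block_sum C \<le> card C * ((card C + 1)\<^sup>2 div 4)"
    unfolding block_sum_def
    using sum_bounded_above[of C "\<lambda>u. \<Sum>w\<in>insert v C. d u w" "(card C + 1)\<^sup>2 div 4"]
      block_transmission_le[OF assms] by simp
  show h: "hub_sum C \<le> (card C + 1)\<^sup>2 div 4"
    unfolding hub_sum_def using block_transmission_le[OF assms] by simp
  have "(2 * int m + 1 - 2 * int (card C)) * int (hub_sum C)
      \<le> (2 * int m + 1 - 2 * int (card C)) * int ((card C + 1)\<^sup>2 div 4)"
    using h card_comp_le[OF assms] by (intro mult_left_mono) auto
  moreover have "int (block_sum C) \<le> int (card C) * int ((card C + 1)\<^sup>2 div 4)"
    using b by (simp only: of_nat_mult[symmetric] of_nat_le_iff)
  ultimately show "int (block_sum C) + (2 * int m + 1 - 2 * int (card C)) * int (hub_sum C)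
      \<le> block_weight m (card C)"
    by (simp add: block_weight_def algebra_simps del: of_nat_div)
qed

text \<open>The total is a combination with positive coefficients of row sums with a common bound.
  Attaining the maximum forces every single row to attain it.\<close>

lemma block_total_eq:
  assumes "C \<in> comps" "u \<in> insert v C"
    and "block_weight m (card C) \<le> int (block_sum C) + (2 * int m + 1 - 2 * int (card C)) * int (hub_sum C)"
  shows "(\<Sum>w\<in>insert v C. d u w) = (card C + 1)\<^sup>2 div 4"
proof -
  define q where "q = (card C + 1)\<^sup>2 div 4"
  define k where "k = 2 * int m + 1 - 2 * int (card C)"
  have k: "0 < k" using card_comp_le[OF assms(1)] by (simp add: k_def)
  have bw: "block_weight m (card C) = int (card C) * int q + k * int q"
    by (simp add: block_weight_def q_def k_def algebra_simps del: of_nat_div)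
  have h: "int (hub_sum C) \<le> int q" using hub_sum_le[OF assms(1)] by (simp only: q_def of_nat_le_iff)
  have b: "int (block_sum C) \<le> int (card C) * int q"
    using block_sum_le[OF assms(1)] by (simp only: q_def of_nat_mult[symmetric] of_nat_le_iff)
  have "k * int (hub_sum C) \<le> k * int q" using h k by simp
  then have kh: "k * int (hub_sum C) = k * int q" and bb: "int (block_sum C) = int (card C) * int q"
    using assms(3) b unfolding bw k_def[symmetric] by linarith+
  show ?thesis unfolding q_def[symmetric]
  proof (cases "u = v")
    case True
    have "hub_sum C = q" using kh k by simp
    then show "(\<Sum>w\<in>insert v C. d u w) = q" using True by (simp only: hub_sum_def)
  next
    case False
    then have u: "u \<in> C" using assms(2) by simp
    have le: "(\<Sum>w\<in>insert v C. d x w) \<le> q" if "x \<in> C" for x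
      using block_transmission_le[OF assms(1), of x] that by (simp add: q_def)
    have "block_sum C = card C * q" using bb by (simp only: of_nat_mult[symmetric] of_nat_eq_iff)
    then have "(\<Sum>x\<in>C. \<Sum>w\<in>insert v C. d x w) = (\<Sum>x\<in>C. q)"
      by (simp only: block_sum_def sum_constant of_nat_id)
    from sum_mono_inv[OF this le u finite_comp[OF assms(1)]]
    show "(\<Sum>w\<in>insert v C. d u w) = q" .
  qed
qed

end

section \<open>Recognising the extremal graph\<close>

text \<open>Walk from \<open>v\<close> without ever turning back. The first repeated vertex must be
  \<open>v\<close>, since any earlier interior vertex already has both its neighbours on the walk.
  The closed walk contains all neighbours of its vertices, so by connectedness it covers
  \<open>K\<close>.\<close>

lemma two_regular_cycle:
  assumes "finite K" "F \<subseteq> K \<times> K" "sym F" "irrefl F"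
    and deg: "\<And>u. u \<in> K \<Longrightarrow> card (F `` {u}) = 2"
    and conn: "\<And>u w. u \<in> K \<Longrightarrow> w \<in> K \<Longrightarrow> (u, w) \<in> F\<^sup>*"
    and "v \<in> K"
  obtains z :: "nat \<Rightarrow> 'a" where "z 0 = v" "z (card K) = v" "inj_on z {..<card K}" "z ` {..<card K} = K"
    "F = (\<lambda>i. (z i, z (Suc i))) ` {..<card K} \<union> (\<lambda>i. (z (Suc i), z i)) ` {..<card K}"
proof -
  have other: "\<exists>c. c \<noteq> a \<and> F `` {b} = {a, c}" if "(a, b) \<in> F" for a b
  proof -
    have "(b, a) \<in> F" "b \<in> K" using that assms(2,3) by (auto dest: symD)
    then show ?thesis using deg[of b] by (auto simp: card_2_iff) (metis Image_singleton_iff doubleton_eq_iff insert_iff singletonD)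
  qed
  obtain a where a: "(v, a) \<in> F"
    using deg[OF \<open>v \<in> K\<close>] by (metis Image_singleton_iff card.empty equals0I zero_neq_numeral)
  \<comment> \<open>The state is an arc rather than a vertex, so that the next step knows where it
    came from.\<close>
  define P where "P n x \<longleftrightarrow> x \<in> F \<and> (n = 0 \<longrightarrow> fst x = v)" for n :: nat and x
  define Q where "Q n x y \<longleftrightarrow> fst y = snd x \<and> snd y \<noteq> fst x \<and> F `` {snd x} = {fst x, snd y}" for n :: nat and x y
  have "\<exists>s. \<forall>n. P n (s n) \<and> Q n (s n) (s (Suc n))"
  proof (rule dependent_nat_choice)
    show "\<exists>x. P 0 x" using a by (auto simp: P_def)
  next
    fix x n assume "P n x"
    then obtain b c where x: "x = (b, c)" "(b, c) \<in> F" by (cases x) (auto simp: P_def)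
    then obtain e where "e \<noteq> b" "F `` {c} = {b, e}" using other by blast
    then show "\<exists>y. P (Suc n) y \<and> Q n x y" using x by (intro exI[of _ "(c, e)"]) (auto simp: P_def Q_def)
  qed
  then obtain s where s: "\<And>n. P n (s n)" "\<And>n. Q n (s n) (s (Suc n))" by blast
  define z where "z i = fst (s i)" for i
  have z0: "z 0 = v" using s(1)[of 0] by (simp add: z_def P_def)
  have z_Suc: "snd (s i) = z (Suc i)" for i using s(2)[of i] by (simp add: z_def Q_def)
  have z_F: "(z i, z (Suc i)) \<in> F" for i
    using s(1)[of i] unfolding P_def by (metis prod.collapse z_Suc z_def)
  have z_F': "(z (Suc i), z i) \<in> F" for i using z_F assms(3) by (meson symD)
  have z_K: "z i \<in> K" for i using z_F assms(2) by blast
  have z_ne: "z (Suc (Suc i)) \<noteq> z i" and z_nbr: "F `` {z (Suc i)} = {z i, z (Suc (Suc i))}" for i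
    using s(2)[of i] by (auto simp: Q_def z_Suc simp flip: z_def)
  have z_ne1: "z (Suc i) \<noteq> z i" for i using z_F[of i] assms(4) by (auto simp: irrefl_def)
  \<comment> \<open>For \<open>i > 0\<close> the vertex \<open>z j\<close> would be one of the two
    known neighbours of \<open>z i\<close>: the predecessor contradicts injectivity, and the
    successor forces the walk to turn back.\<close>
  have return: "i = 0" if inj: "inj_on z {..j}" and "i \<le> j" and eq: "z (Suc j) = z i" for i j
  proof (rule ccontr)
    assume "i \<noteq> 0"
    then obtain k where i: "i = Suc k" by (cases i) auto
    have "z j \<in> F `` {z (Suc k)}" using z_F'[of j] eq i by simp
    then consider "z j = z k" | "z j = z (Suc i)" using z_nbr i by auto
    then show False
    proof cases
      case 1
      then show False using inj_onD[OF inj, of j k] i \<open>i \<le> j\<close> by simp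
    next
      case 2
      have "i \<noteq> j" using eq z_ne1 by metis
      then have "j = Suc i" using inj_onD[OF inj 2] \<open>i \<le> j\<close> by simp
      then show False using eq z_ne by metis
    qed
  qed
  have nbr0: "F `` {z 0} = {z (Suc 0), z j}" if inj: "inj_on z {..j}" and eq: "z (Suc j) = z 0" for j
  proof -
    have "j \<noteq> 0" "j \<noteq> Suc 0" using eq z_ne1 z_ne by metis+
    then have ne: "z (Suc 0) \<noteq> z j" using inj_onD[OF inj, of "Suc 0" j] by auto
    have sub: "{z (Suc 0), z j} \<subseteq> F `` {z 0}" using z_F[of 0] z_F'[of j] eq by auto
    have "card (F `` {z 0}) = 2" using deg z_K by blast
    with sub ne show ?thesis by (metis card_2_iff card_gt_0_iff card_subset_eq zero_less_numeral)
  qed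
  have closed: "z ` {..j} = K" if inj: "inj_on z {..j}" and eq: "z (Suc j) = z 0" for j
  proof
    show "z ` {..j} \<subseteq> K" using z_K by auto
    have step: "y \<in> z ` {..j}" if x: "x \<in> z ` {..j}" and "(x, y) \<in> F" for x y
    proof -
      obtain i where i: "i \<le> j" "x = z i" using x by auto
      show ?thesis
      proof (cases i)
        case 0
        then have "y \<in> {z (Suc 0), z j}" using nbr0[OF inj eq] \<open>(x, y) \<in> F\<close> i by auto
        moreover have "j \<noteq> 0" using eq z_ne1 by metis
        ultimately show ?thesis by auto
      next
        case (Suc k)
        then have "y \<in> {z k, z (Suc i)}" using z_nbr[of k] \<open>(x, y) \<in> F\<close> i by auto
        moreover have "z (Suc i) \<in> z ` {..j}" using i eq by (cases "i = j") auto
        ultimately show ?thesis using i Suc by auto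
      qed
    qed
    show "K \<subseteq> z ` {..j}"
    proof
      fix w assume "w \<in> K"
      then have "(z 0, w) \<in> F\<^sup>*" using conn z_K by blast
      then show "w \<in> z ` {..j}" by (induction rule: rtrancl_induct) (use step in auto)
    qed
  qed
  \<comment> \<open>A repetition would close the walk, which would then cover \<open>K\<close> with
    too few vertices.\<close>
  have inj: "inj_on z {..j}" if "j < card K" for j
    using that
  proof (induction j)
    case (Suc j)
    then have IH: "inj_on z {..j}" by simp
    have "z (Suc j) \<notin> z ` {..j}"
    proof
      assume "z (Suc j) \<in> z ` {..j}"
      then have "z (Suc j) = z 0" using return[OF IH] by auto
      then have "z ` {..j} = K" using closed IH by blast
      then show False using Suc.prems card_image[OF IH] by simp
    qed
    then show ?case using IH by (simp add: atMost_Suc)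
  qed simp
  obtain j where j: "card K = Suc j" using \<open>v \<in> K\<close> assms(1) by (metis card_gt_0_iff empty_iff gr0_implies_Suc)
  have inj_j: "inj_on z {..j}" using inj j by simp
  then have "card (z ` {..j}) = card K" using j by (simp add: card_image)
  then have img: "z ` {..j} = K" using assms(1) z_K by (metis card_subset_eq image_subsetI)
  then have wrap: "z (Suc j) = z 0" using return[OF inj_j] z_K[of "Suc j"] by (metis atMost_iff imageE)
  show thesis
  proof (rule that[of z])
    show "F = (\<lambda>i. (z i, z (Suc i))) ` {..<card K} \<union> (\<lambda>i. (z (Suc i), z i)) ` {..<card K}"
    proof (intro equalityI subsetI)
      fix e assume e: "e \<in> F"
      then obtain x y where xy: "e = (x, y)" "(x, y) \<in> F" "x \<in> K" using assms(2) by auto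
      then obtain i where i: "i \<le> j" "x = z i" using img by auto
      show "e \<in> (\<lambda>i. (z i, z (Suc i))) ` {..<card K} \<union> (\<lambda>i. (z (Suc i), z i)) ` {..<card K}"
      proof (cases i)
        case 0
        then have "y = z (Suc 0) \<or> y = z j" using nbr0[OF inj_j wrap] xy i by auto
        then have "e = (z 0, z (Suc 0)) \<or> e = (z (Suc j), z j)" using xy i 0 wrap by auto
        then show ?thesis unfolding j by auto
      next
        case (Suc k)
        then have "y = z k \<or> y = z (Suc i)" using z_nbr[of k] xy i by auto
        then have "e = (z (Suc k), z k) \<or> e = (z i, z (Suc i))" using xy i Suc by auto
        moreover have "k < card K" "i < card K" using i Suc j by auto
        ultimately show ?thesis by blast
      qed
    qed (use z_F z_F' in auto)
  qed (use z0 wrap j inj_j img in \<open>auto simp: lessThan_Suc_atMost\<close>)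
qed

text \<open>Writing the cycle with \<open>Suc i mod m\<close> gives the closing edge the same form
  as the others.\<close>

lemma parcs_lollipop_pendant:
  assumes "2 \<le> m"
  shows "parcs (lollipop (Suc m) m) =
    (let E = insert (m - 1, m) ((\<lambda>i. (i, Suc i mod m)) ` {..<m}) in E \<union> E\<inverse>)"
proof -
  have "{(i, i + 1) |i. i + 1 < m} \<union> {(m - 1, 0)} = (\<lambda>i. (i, Suc i mod m)) ` {..<m}"
  proof (intro equalityI subsetI)
    fix e assume "e \<in> (\<lambda>i. (i, Suc i mod m)) ` {..<m}"
    then obtain i where i: "i < m" "e = (i, Suc i mod m)" by auto
    show "e \<in> {(i, i + 1) |i. i + 1 < m} \<union> {(m - 1, 0)}"
      using i by (cases "Suc i = m") auto
  qed (use assms in \<open>auto simp: image_iff intro: bexI[of _ "m - 1"]\<close>)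
  moreover have "{(i, i + 1) |i. m - 1 \<le> i \<and> i + 1 < Suc m} = {(m - 1, m)}"
    using assms by auto
  ultimately show ?thesis unfolding lollipop_def Let_def by auto
qed

text \<open>The lollipop is glued at index \<open>m - 1\<close>, whereas the enumeration
  \<open>z\<close> starts at the cut vertex. Shifting the closed enumeration by one leaves its edges
  unchanged.\<close>

lemma cyclic_shift_edges:
  fixes z :: "nat \<Rightarrow> 'a"
  assumes "0 < m" "z m = z 0"
  shows "(\<lambda>i. (z (Suc i), z (Suc (Suc i mod m)))) ` {..<m} = (\<lambda>i. (z i, z (Suc i))) ` {..<m}"
proof (intro equalityI subsetI)
  fix e assume "e \<in> (\<lambda>i. (z (Suc i), z (Suc (Suc i mod m)))) ` {..<m}"
  then obtain i where i: "i < m" "e = (z (Suc i), z (Suc (Suc i mod m)))" by auto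
  show "e \<in> (\<lambda>i. (z i, z (Suc i))) ` {..<m}"
  proof (cases "Suc i = m")
    case True
    then have "e = (z 0, z (Suc 0))" using i assms by simp
    then show ?thesis using assms by auto
  next
    case False
    then have "e = (z (Suc i), z (Suc (Suc i)))" "Suc i < m" using i by auto
    then show ?thesis by blast
  qed
next
  fix e assume "e \<in> (\<lambda>i. (z i, z (Suc i))) ` {..<m}"
  then obtain i where i: "i < m" "e = (z i, z (Suc i))" by auto
  define j where "j = (if i = 0 then m - 1 else i - 1)"
  have "j < m" "Suc j mod m = i" "z (Suc j) = z i" using i assms by (auto simp: j_def)
  then have "e = (z (Suc j), z (Suc (Suc j mod m)))" using i by simp
  then show "e \<in> (\<lambda>i. (z (Suc i), z (Suc (Suc i mod m)))) ` {..<m}" using \<open>j < m\<close> by blast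
qed

section \<open>The upper bound and the graphs attaining it\<close>

context one_cut_graph
begin

lemma one_le_card_comp: "C \<in> comps \<Longrightarrow> 1 \<le> card C"
  using finite_comp comps_nonempty by (simp add: Suc_le_eq card_gt_0_iff)

lemma block_weights_le:
  assumes "7 \<le> card V" "2 \<le> card comps"
  shows "(\<Sum>C\<in>comps. block_weight m (card C)) \<le> 2 * int m + (int m + 2) * int (m\<^sup>2 div 4)"
  using assms by (intro block_weight_sum_le finite_comps sum_card_comps one_le_card_comp) auto

lemma total_distance_le:
  assumes "7 \<le> card V" "2 \<le> card comps"
  shows "int (\<Sum>u\<in>V. \<Sum>w\<in>V. d u w) \<le> 2 * int m + (int m + 2) * int (m\<^sup>2 div 4)"
  using total_distance_le_sum sum_mono[OF block_total_le, of comps "\<lambda>C. C"] block_weights_le[OF assms]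
  by linarith

text \<open>Attaining the bound makes every estimate tight: the sizes are \<open>m - 1\<close> and
  1, the large block is connected and 2-regular, hence a cycle, and the remaining vertex can only be
  joined to \<open>v\<close>.\<close>

lemma lollipop_embedding:
  assumes "7 \<le> card V" "2 \<le> card comps"
    and large: "2 * int m + (int m + 2) * int (m\<^sup>2 div 4) \<le> int (\<Sum>u\<in>V. \<Sum>w\<in>V. d u w)"
  obtains h :: "nat \<Rightarrow> 'a" where "inj_on h {..<card V}" "h ` {..<card V} = V"
    "map_prod h h ` parcs (lollipop (card V) (card V - 1)) = E"
proof -
  define B where "B C = int (block_sum C) + (2 * int m + 1 - 2 * int (card C)) * int (hub_sum C)" for C
  have B_le: "B C \<le> block_weight m (card C)" if "C \<in> comps" for C
    unfolding B_def by (rule block_total_le[OF that])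
  have m: "6 \<le> m" using assms(1) by simp
  have "(\<Sum>C\<in>comps. block_weight m (card C)) \<le> 2 * int m + (int m + 2) * int (m\<^sup>2 div 4)"
    using assms(1,2) by (rule block_weights_le)
  moreover have "(\<Sum>C\<in>comps. B C) \<le> (\<Sum>C\<in>comps. block_weight m (card C))"
    by (rule sum_mono) (rule B_le)
  ultimately have eqs: "(\<Sum>C\<in>comps. block_weight m (card C)) = 2 * int m + (int m + 2) * int (m\<^sup>2 div 4)"
    "(\<Sum>C\<in>comps. B C) = (\<Sum>C\<in>comps. block_weight m (card C))"
    using total_distance_le_sum large unfolding B_def by linarith+
  obtain C D where CD: "comps = {C, D}" "C \<noteq> D" "card C = m - 1" "card D = 1"
    using block_weight_sum_eq[OF m finite_comps assms(2) one_le_card_comp sum_card_comps eqs(1)] by blast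
  obtain p where p: "D = {p}" using CD(4) by (rule card_1_singletonE)
  have C: "C \<in> comps" and D: "{p} \<in> comps" using CD p by auto
  have BC: "B C = block_weight m (card C)"
    by (rule sum_mono_inv[OF eqs(2) B_le C finite_comps])
  define K where "K = insert v C"
  define F where "F = Restr E K"
  have K: "finite K" "card K = m" "v \<in> K" "K \<subseteq> V"
    using finite_comp[OF C] card_block[OF C] CD(3) m comps_subset[OF C] v_in_V by (auto simp: K_def)
  have p_ne: "p \<in> V" "p \<noteq> v" "p \<notin> K"
    using comps_subset[OF D] comps_disjoint[OF C D] CD(2) p by (auto simp: K_def)
  have V: "V = insert p K"
    using comps_Union v_in_V unfolding CD(1) p K_def by auto
  have deg: "card (F `` {u}) = 2" if "u \<in> K" for u
  proof -
    have "F `` {u} = {x \<in> K. (u, x) \<in> E}" using that by (auto simp: F_def)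
    moreover have "(\<Sum>w\<in>insert v C. d u w) = (card C + 1)\<^sup>2 div 4"
      by (rule block_total_eq[OF C]) (use BC that in \<open>simp_all add: B_def K_def\<close>)
    ultimately show ?thesis
      using block_degree_eq_2[OF C, of u] that CD(3) m by (simp add: K_def)
  qed
  have F: "F \<subseteq> K \<times> K" "sym F" "irrefl F"
    using sym_E irrefl_E by (auto simp: F_def sym_def irrefl_def)
  have "F `` {v} \<noteq> {}" using deg[OF K(3)] by fastforce
  then obtain c where c: "(v, c) \<in> F" by blast
  then have cC: "c \<in> C" using F(3) F(1) by (auto simp: K_def irrefl_def)
  obtain c' where c': "c' \<in> V - {v}" "C = comp c'" using C by (auto simp: comps_def)
  \<comment> \<open>Leave \<open>v\<close> through its neighbour \<open>c\<close>; a walk in the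
    graph without \<open>v\<close> that starts in \<open>C\<close> stays in \<open>C\<close>, hence
    in the block.\<close>
  have from_v: "(v, w) \<in> F\<^sup>*" if "w \<in> K" for w
  proof (cases "w = v")
    case False
    then have "w \<in> comp c" using comp_eq[of c c'] cC c' that by (simp add: K_def)
    then have "(c, w) \<in> R\<^sup>*" by (simp add: comp_def)
    then have "w \<in> C \<and> (c, w) \<in> F\<^sup>*"
    proof (induction rule: rtrancl_induct)
      case (step x y)
      then have "y \<in> C" using comp_closed[OF c'(1), of x y] c'(2) by (simp add: R_def)
      then show ?case using step by (auto simp: F_def R_def K_def intro: rtrancl_into_rtrancl)
    qed (simp add: cC)
    then show ?thesis using c by (meson converse_rtrancl_into_rtrancl)
  qed simp
  have conn: "(u, w) \<in> F\<^sup>*" if "u \<in> K" "w \<in> K" for u w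
    using from_v that sym_rtrancl[OF F(2)] by (meson rtrancl_trans symD)
  obtain z where z: "z 0 = v" "z m = v" "inj_on z {..<m}" "z ` {..<m} = K"
    "F = (\<lambda>i. (z i, z (Suc i))) ` {..<m} \<union> (\<lambda>i. (z (Suc i), z i)) ` {..<m}"
    by (rule two_regular_cycle[OF K(1) F deg conn K(3), unfolded K(2)])
  have edge_p: "y = v" if "(p, y) \<in> E" for y
  proof (rule ccontr)
    assume "y \<noteq> v"
    obtain p' where "p' \<in> V - {v}" "{p} = comp p'" using D by (auto simp: comps_def)
    then have "y = p" using comp_closed[of p' p y] that \<open>y \<noteq> v\<close> by blast
    then show False using that irrefl_E by (simp add: irrefl_def)
  qed
  have "(p, v) \<in> E"
    using connected_E[OF p_ne(1) v_in_V] p_ne(2) edge_p by (blast elim: converse_rtranclE)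
  then have pv: "(p, v) \<in> E" "(v, p) \<in> E" using sym_E by (auto dest: symD)
  have "(x, y) \<in> E \<longleftrightarrow> (x, y) \<in> F \<or> (x, y) = (v, p) \<or> (x, y) = (p, v)" for x y
  proof
    assume xy: "(x, y) \<in> E"
    then have yx: "(y, x) \<in> E" using sym_E by (auto dest: symD)
    have "x \<in> insert p K" "y \<in> insert p K" using xy E_subset V by blast+
    moreover have "(x, y) = (p, v)" if "x = p" using edge_p xy that by blast
    moreover have "(x, y) = (v, p)" if "y = p" using edge_p yx that by blast
    ultimately show "(x, y) \<in> F \<or> (x, y) = (v, p) \<or> (x, y) = (p, v)" using xy unfolding F_def by blast
  qed (use pv in \<open>auto simp: F_def\<close>)
  then have E: "E = F \<union> {(v, p), (p, v)}" by auto
  \<comment> \<open>The shift puts \<open>v = z m\<close> at index \<open>m - 1\<close>, where the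
    pendant vertex \<open>m\<close> of the lollipop is attached.\<close>
  define h where "h i = (if i < m then z (Suc i) else p)" for i
  have cV: "{..<card V} = insert m {..<m}" using assms(1) by auto
  have "Suc m = card V" using assms(1) by simp
  then have L: "parcs (lollipop (card V) m) =
      (let E = insert (m - 1, m) ((\<lambda>i. (i, Suc i mod m)) ` {..<m}) in E \<union> E\<inverse>)"
    using parcs_lollipop_pendant[of m] m by simp
  have img: "(\<lambda>i. z (Suc i)) ` {..<m} = K"
  proof -
    have "(\<lambda>i. z (Suc i)) ` {..<m} = z ` Suc ` {..<m}" by (simp add: image_image)
    also have "\<dots> = z ` {1..m}" by (simp add: image_Suc_lessThan)
    also have "{1..m} = insert m ({..<m} - {0})" using m by auto
    also have "z ` \<dots> = z ` insert 0 ({..<m} - {0})" by (simp only: image_insert z(1,2))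
    also have "insert 0 ({..<m} - {0}) = {..<m}" using m by auto
    finally show ?thesis using z(4) by simp
  qed
  then have inj: "inj_on (\<lambda>i. z (Suc i)) {..<m}"
    using K by (intro eq_card_imp_inj_on) auto
  have h_eq: "h i = z (Suc i)" if "i < m" for i using that by (simp add: h_def)
  have h_m: "h m = p" by (simp add: h_def)
  have h_img: "h ` {..<m} = K" unfolding img[symmetric] by (rule image_cong) (simp_all add: h_def)
  have "inj_on h {..<m} \<longleftrightarrow> inj_on (\<lambda>i. z (Suc i)) {..<m}" by (rule inj_on_cong) (simp add: h_def)
  then have "inj_on h {..<m}" using inj by (rule iffD2)
  moreover have "h m \<notin> h ` ({..<m} - {m})" using p_ne(3) unfolding h_m h_img[symmetric] by blast
  ultimately have "inj_on h {..<card V}"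
    unfolding cV inj_on_insert by blast
  moreover have "h ` {..<card V} = V"
    unfolding cV image_insert h_img h_m V[symmetric] ..
  moreover have "map_prod h h ` parcs (lollipop (card V) (card V - 1)) = E"
  proof -
    have h_mod: "h (Suc i mod m) = z (Suc (Suc i mod m))" for i using m by (simp add: h_eq)
    have "(\<lambda>i. (h i, h (Suc i mod m))) ` {..<m} = (\<lambda>i. (z (Suc i), z (Suc (Suc i mod m)))) ` {..<m}"
      by (rule image_cong) (simp_all add: h_eq h_mod)
    also have "\<dots> = (\<lambda>i. (z i, z (Suc i))) ` {..<m}"
      by (rule cyclic_shift_edges) (use m z in auto)
    finally have "(\<lambda>i. (h i, h (Suc i mod m))) ` {..<m} = (\<lambda>i. (z i, z (Suc i))) ` {..<m}" .
    moreover have "h (m - 1) = v"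
    proof -
      have "Suc (m - 1) = m" "m - 1 < m" using m by simp_all
      then show ?thesis using h_eq[of "m - 1"] z(2) by (simp only:)
    qed
    ultimately have "map_prod h h ` insert (m - 1, m) ((\<lambda>i. (i, Suc i mod m)) ` {..<m})
        = insert (v, p) ((\<lambda>i. (z i, z (Suc i))) ` {..<m})" (is "_ ` ?L = ?M")
      by (simp only: image_insert image_image map_prod_simp h_m)
    moreover have "map_prod h h ` (?L \<union> ?L\<inverse>) = map_prod h h ` ?L \<union> (map_prod h h ` ?L)\<inverse>"
      by force
    moreover have "?M \<union> ?M\<inverse> = E" unfolding E z(5) by auto
    ultimately show ?thesis unfolding L Let_def by (simp only:)
  qed
  ultimately show thesis by (rule that)
qed

end

section \<open>The Wiener index\<close>

text \<open>Walks of length \<open>k\<close> correspond to pairs in the \<open>k\<close>-th relation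
  power and have cost \<open>k\<close>, so the infimum is attained by a shortest walk.\<close>

lemma distance_eq_rdist:
  assumes "pair_wf_digraph G" "u \<in> pverts G" "(u, w) \<in> (parcs G)\<^sup>*"
  shows "distance (with_proj G) u w = ereal (real (rdist (parcs G) u w))"
proof -
  interpret pair_wf_digraph G by fact
  have cost: "awalk_cost (\<lambda>_. 1) p = real (length p)" for p
    by (simp add: awalk_cost_def sum_list_triv)
  have walk_relpow: "(u, w) \<in> parcs G ^^ length p" if "awalk u p w" for u p
    using that by (induction p arbitrary: u) (auto simp: awalk_simps intro!: relpow_Suc_I2 simp del: relpow.simps(2))
  have relpow_walk: "\<exists>p. awalk u p w \<and> length p = k" if "(u, w) \<in> parcs G ^^ k" "u \<in> pverts G" for u k
    using that
  proof (induction k arbitrary: u)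
    case 0
    then show ?case by (auto simp: awalk_Nil_iff)
  next
    case (Suc k)
    then obtain x where x: "(u, x) \<in> parcs G" "(x, w) \<in> parcs G ^^ k" by (meson relpow_Suc_D2)
    then obtain p where "awalk x p w" "length p = k" using Suc.IH in_arcsD2 by blast
    then show ?case using x in_arcsD1[OF x(1)] by (intro exI[of _ "(u, x) # p"]) (auto simp: awalk_Cons_iff)
  qed
  obtain p where p: "awalk u p w" "length p = rdist (parcs G) u w"
    using relpow_walk[OF rdist_relpow[OF assms(3)] assms(2)] by blast
  show ?thesis unfolding distance_def \<mu>_def
  proof (rule antisym)
    show "(INF p\<in>{p. awalk u p w}. ereal (awalk_cost (\<lambda>_. 1) p)) \<le> ereal (real (rdist (parcs G) u w))"
      using p by (intro INF_lower2[of p]) (auto simp: cost)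
    show "ereal (real (rdist (parcs G) u w)) \<le> (INF p\<in>{p. awalk u p w}. ereal (awalk_cost (\<lambda>_. 1) p))"
      by (intro INF_greatest) (auto simp: cost intro: rdist_le walk_relpow)
  qed
qed

text \<open>Ordered pairs count each distance twice. Providing twice the index as a natural number
  avoids both halves and \<open>ereal\<close> arithmetic later.\<close>

lemma wiener_index_double_sum:
  assumes "pair_graph G" and "\<And>u w. u \<in> pverts G \<Longrightarrow> w \<in> pverts G \<Longrightarrow> (u, w) \<in> (parcs G)\<^sup>*"
  shows "\<exists>W. wiener_index (with_proj G) = ereal (real W) \<and>
    2 * W = (\<Sum>u\<in>pverts G. \<Sum>w\<in>pverts G. rdist (parcs G) u w)"
proof -
  interpret pair_graph G by fact
  let ?V = "pverts G" and ?d = "rdist (parcs G)"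
  have sym: "?d u w = ?d w u" for u w
    by (rule rdist_sym) (use arcs_symmetric in \<open>auto simp: sym_def\<close>)
  define S where "S = {e. e \<subseteq> ?V \<and> card e = 2}"
  define q where "q e = (THE k. \<exists>u w. e = {u, w} \<and> k = ?d u w)" for e
  have q: "q {u, w} = ?d u w" for u w
    unfolding q_def by (rule the_equality) (auto simp: doubleton_eq_iff sym)
  have S_elim: "\<exists>a b. e = {a, b} \<and> a \<noteq> b \<and> a \<in> ?V \<and> b \<in> ?V" if "e \<in> S" for e
    using that by (auto simp: S_def card_2_iff)
  have fin: "finite ?V" by (rule pair_finite_verts)
  then have fin_S: "finite S" unfolding S_def by simp
  have pd: "pair_distance (with_proj G) e = ereal (real (q e))" if "e \<in> S" for e
  proof -
    obtain a b where e: "e = {a, b}" "a \<in> ?V" "b \<in> ?V" using S_elim[OF \<open>e \<in> S\<close>] by blast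
    have "pair_distance (with_proj G) {a, b} = distance (with_proj G) a b"
      by (rule pair_distance_doubleton) unfold_locales
    also have "\<dots> = ereal (real (?d a b))"
      by (rule distance_eq_rdist) (use e assms(2) in \<open>auto intro: pair_wf_digraph\<close>)
    finally show ?thesis unfolding e(1) q .
  qed
  have "wiener_index (with_proj G) = (\<Sum>e\<in>S. pair_distance (with_proj G) e)"
    by (simp add: wiener_index_def S_def)
  also have "\<dots> = (\<Sum>e\<in>S. ereal (real (q e)))" by (rule sum.cong) (simp_all add: pd)
  also have "\<dots> = ereal (real (\<Sum>e\<in>S. q e))" by (simp add: sum_ereal)
  finally have W: "wiener_index (with_proj G) = ereal (real (\<Sum>e\<in>S. q e))" .
  let ?P = "{x \<in> ?V \<times> ?V. fst x \<noteq> snd x}"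
  let ?g = "\<lambda>x. {fst x, snd x}"
  \<comment> \<open>Ordered pairs are grouped by their underlying set; each group has two members
    with equal distances.\<close>
  have "2 * (\<Sum>e\<in>S. q e) = (\<Sum>e\<in>S. \<Sum>x\<in>{x \<in> ?P. ?g x = e}. ?d (fst x) (snd x))"
    unfolding sum_distrib_left
  proof (rule sum.cong)
    fix e assume "e \<in> S"
    then obtain a b where e: "e = {a, b}" "a \<noteq> b" "a \<in> ?V" "b \<in> ?V" using S_elim by blast
    then have "{x \<in> ?P. ?g x = e} = {(a, b), (b, a)}" by (auto simp: doubleton_eq_iff)
    then show "2 * q e = (\<Sum>x\<in>{x \<in> ?P. ?g x = e}. ?d (fst x) (snd x))"
      using e by (simp add: q sym[of b a])
  qed simp
  also have "\<dots> = (\<Sum>x\<in>?P. ?d (fst x) (snd x))"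
    using fin fin_S by (intro sum.group) (auto simp: S_def)
  also have "\<dots> = (\<Sum>x\<in>?V \<times> ?V. ?d (fst x) (snd x))"
    using fin by (intro sum.mono_neutral_left) auto
  also have "\<dots> = (\<Sum>u\<in>?V. \<Sum>w\<in>?V. ?d u w)"
    by (simp add: sum.cartesian_product case_prod_unfold)
  finally show ?thesis using W by blast
qed

section \<open>Connectivity and isomorphism of digraphs in terms of relations\<close>

lemma rtrancl_on_iff: "(u, w) \<in> rtrancl_on F r \<longleftrightarrow> u \<in> F \<and> (u, w) \<in> (Restr r F)\<^sup>*"
proof
  assume "(u, w) \<in> rtrancl_on F r"
  then show "u \<in> F \<and> (u, w) \<in> (Restr r F)\<^sup>*"
    by (induction rule: rtrancl_on_induct) (auto intro: rtrancl_into_rtrancl)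
next
  assume *: "u \<in> F \<and> (u, w) \<in> (Restr r F)\<^sup>*"
  then have "(u, w) \<in> (Restr r F)\<^sup>*" by simp
  then show "(u, w) \<in> rtrancl_on F r"
    by (induction rule: rtrancl_induct) (use * in \<open>auto intro: rtrancl_on_into_rtrancl_on\<close>)
qed

lemma connected_iff_Restr_rtrancl:
  assumes "sym (arcs_ends G)"
  shows "connected G \<longleftrightarrow> verts G \<noteq> {} \<and>
    (\<forall>u\<in>verts G. \<forall>w\<in>verts G. (u, w) \<in> (Restr (arcs_ends G) (verts G))\<^sup>*)"
proof -
  have "symcl (arcs_ends G) = arcs_ends G" using assms by (auto simp: symcl_def sym_def)
  then show ?thesis unfolding connected_conv by (auto simp: rtrancl_on_iff)
qed

lemma digraph_iso_sym:
  assumes "wf_digraph G" "digraph_iso G H"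
  shows "digraph_iso H G"
proof -
  interpret wf_digraph G by fact
  obtain f where "digraph_isomorphism f" "H = app_iso f G" using assms(2) by (auto simp: digraph_iso_def)
  then show ?thesis unfolding digraph_iso_def
    using digraph_isomorphism_invI app_iso_inv by metis
qed

lemma digraph_iso_with_projI:
  assumes "pair_wf_digraph G" "inj_on h (pverts G)" "h ` pverts G = pverts H"
    "map_prod h h ` parcs G = parcs H"
  shows "digraph_iso (with_proj G) (with_proj H)"
proof -
  interpret pair_wf_digraph G by fact
  define f where "f = \<lparr>iso_verts = h, iso_arcs = map_prod h h, iso_head = snd, iso_tail = fst\<rparr>"
  have "parcs G \<subseteq> pverts G \<times> pverts G" using in_arcsD1 in_arcsD2 by auto
  then have "inj_on (map_prod h h) (parcs G)"
    using map_prod_inj_on[OF assms(2,2)] inj_on_subset by blast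
  then have "digraph_isomorphism f"
    unfolding digraph_isomorphism_def f_def using assms(2) by (auto intro: wf_digraph_axioms)
  moreover have "with_proj H = app_iso f (with_proj G)"
    using assms(3,4) by (simp add: f_def app_iso_def with_proj_def)
  ultimately show ?thesis unfolding digraph_iso_def by blast
qed

text \<open>An isomorphism maps walks to walks of the same cost. The converse inequality comes from
  applying this to the inverse.\<close>

lemma distance_app_iso_le:
  assumes "wf_digraph G" "pre_digraph.digraph_isomorphism G f"
  shows "distance (app_iso f G) (iso_verts f u) (iso_verts f w) \<le> distance G u w"
proof -
  interpret wf_digraph G by fact
  interpret H: wf_digraph "app_iso f G" using assms(2) ..
  have "H.awalk_cost (\<lambda>_. 1) (map (iso_arcs f) p) = awalk_cost (\<lambda>_. 1) p" for p
    by (simp add: awalk_cost_def H.awalk_cost_def o_def sum_list_triv)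
  then show ?thesis unfolding distance_def \<mu>_def H.\<mu>_def
    by (intro INF_mono) (use awalk_app_isoI[OF _ assms(2)] in force)
qed

lemma distance_app_iso:
  assumes "wf_digraph G" "pre_digraph.digraph_isomorphism G f" "u \<in> verts G" "w \<in> verts G"
  shows "distance (app_iso f G) (iso_verts f u) (iso_verts f w) = distance G u w"
proof -
  interpret wf_digraph G by fact
  have "distance (app_iso (inv_iso f) (app_iso f G)) (iso_verts (inv_iso f) (iso_verts f u))
      (iso_verts (inv_iso f) (iso_verts f w)) \<le> distance (app_iso f G) (iso_verts f u) (iso_verts f w)"
    by (intro distance_app_iso_le digraph_isomorphism_invI assms(2) wf_digraphI_app_iso)
  then show ?thesis using distance_app_iso_le[OF assms(1,2), of u w] assms(2-4) by simp
qed

lemma digraph_iso_wiener_index_eq: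
  assumes "pair_graph G" "pair_graph H" "digraph_iso (with_proj G) (with_proj H)"
    and conn_G: "\<And>u w. u \<in> pverts G \<Longrightarrow> w \<in> pverts G \<Longrightarrow> (u, w) \<in> (parcs G)\<^sup>*"
    and conn_H: "\<And>u w. u \<in> pverts H \<Longrightarrow> w \<in> pverts H \<Longrightarrow> (u, w) \<in> (parcs H)\<^sup>*"
  shows "wiener_index (with_proj G) = wiener_index (with_proj H)"
proof -
  interpret G: pair_graph G by fact
  interpret H: pair_graph H by fact
  obtain f where f: "G.digraph_isomorphism f" "with_proj H = app_iso f (with_proj G)"
    using assms(3) by (auto simp: digraph_iso_def)
  define h where "h = iso_verts f"
  have inj: "inj_on h (pverts G)" using G.digraph_isomorphism_inj_on_verts[OF f(1)] by (simp add: h_def)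
  have img: "pverts H = h ` pverts G" using arg_cong[OF f(2), of verts] by (simp add: h_def)
  have d: "rdist (parcs H) (h u) (h w) = rdist (parcs G) u w" if "u \<in> pverts G" "w \<in> pverts G" for u w
  proof -
    have "ereal (real (rdist (parcs H) (h u) (h w))) = distance (with_proj H) (h u) (h w)"
      using that img by (intro distance_eq_rdist[symmetric] conn_H) (auto intro: H.pair_wf_digraph)
    also have "\<dots> = distance (with_proj G) u w"
      unfolding f(2) h_def using that by (intro distance_app_iso f(1)) (auto intro: G.wf_digraph_axioms)
    also have "\<dots> = ereal (real (rdist (parcs G) u w))"
      using that by (intro distance_eq_rdist conn_G) (auto intro: G.pair_wf_digraph)
    finally show ?thesis by simp
  qed
  obtain W where W: "wiener_index (with_proj G) = ereal (real W)"
    "2 * W = (\<Sum>u\<in>pverts G. \<Sum>w\<in>pverts G. rdist (parcs G) u w)"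
    using wiener_index_double_sum[OF assms(1) conn_G] by blast
  obtain W' where W': "wiener_index (with_proj H) = ereal (real W')"
    "2 * W' = (\<Sum>u\<in>pverts H. \<Sum>w\<in>pverts H. rdist (parcs H) u w)"
    using wiener_index_double_sum[OF assms(2) conn_H] by blast
  have "2 * W' = 2 * W"
    unfolding W(2) W'(2) img by (simp add: sum.reindex[OF inj] d)
  then show ?thesis using W(1) W'(1) by simp
qed

section \<open>Distances in the extremal graph\<close>

text \<open>With truncated subtraction, \<open>(i - j) + (j - i)\<close> is the absolute difference.\<close>

definition cycle_dist :: "nat \<Rightarrow> nat \<Rightarrow> nat \<Rightarrow> nat" where
  "cycle_dist m i j = min ((i - j) + (j - i)) (m - ((i - j) + (j - i)))"

lemma cycle_dist_Suc:
  "cycle_dist m i (Suc j) \<le> Suc (cycle_dist m i j)" "cycle_dist m i j \<le> Suc (cycle_dist m i (Suc j))"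
proof -
  show "cycle_dist m i (Suc j) \<le> Suc (cycle_dist m i j)"
    by (cases "i \<le> j") (auto simp: cycle_dist_def)
  show "cycle_dist m i j \<le> Suc (cycle_dist m i (Suc j))"
    by (cases "i \<le> j") (auto simp: cycle_dist_def)
qed

lemma cycle_dist_wrap:
  assumes "i < m"
  shows "cycle_dist m i 0 \<le> Suc (cycle_dist m i (m - 1))" "cycle_dist m i (m - 1) \<le> Suc (cycle_dist m i 0)"
  using assms by (auto simp: cycle_dist_def)

text \<open>Induction in steps of two: the term at 0 vanishes, and after a shift each of the
  \<open>m + 1\<close> remaining terms exceeds an old one by 1, the term at \<open>s = m\<close>
  being 0 before.\<close>

lemma sum_min: "(\<Sum>t<m. min t (m - t)) = m\<^sup>2 div 4" for m :: nat
proof (induction m rule: nat_induct2)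
  case (step m)
  have "(\<Sum>t<m + 2. min t (m + 2 - t)) = (\<Sum>s<Suc m. min (Suc s) (m + 2 - Suc s))"
    using sum.lessThan_Suc_shift[of "\<lambda>t. min t (m + 2 - t)" "Suc m"] by simp
  also have "\<dots> = (\<Sum>s<Suc m. Suc (min s (m - s)))"
    by (intro sum.cong) auto
  also have "\<dots> = Suc m + (\<Sum>s<m. min s (m - s))" by (simp add: sum.distrib sum_Suc)
  finally show ?case using step by (simp add: power2_eq_square)
qed simp_all

text \<open>Rotate the cycle so that \<open>t\<close> is the number of forward steps from
  \<open>i\<close> to \<open>j\<close>.\<close>

lemma sum_cycle_dist:
  assumes "i < m"
  shows "(\<Sum>j<m. cycle_dist m i j) = m\<^sup>2 div 4"
proof -
  have "(\<Sum>j<m. cycle_dist m i j) = (\<Sum>t<m. min t (m - t))"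
    by (rule sum.reindex_bij_witness[where i = "\<lambda>t. if t + i < m then t + i else t + i - m"
          and j = "\<lambda>j. if i \<le> j then j - i else j + m - i"])
      (use assms in \<open>auto simp: cycle_dist_def\<close>)
  then show ?thesis by (simp add: sum_min)
qed

lemma lollipop_reachable:
  assumes "i < Suc m" "j < Suc m"
  shows "(i, j) \<in> (parcs (lollipop (Suc m) m))\<^sup>*"
proof -
  let ?E = "parcs (lollipop (Suc m) m)"
  have edge: "(i, Suc i) \<in> ?E" if "Suc i < Suc m" for i
  proof (cases "Suc i < m")
    case True
    then show ?thesis by (auto simp: lollipop_def Let_def)
  next
    case False
    then show ?thesis using that by (auto simp: lollipop_def Let_def)
  qed
  have "sym ?E" by (auto simp: lollipop_def Let_def sym_def)
  moreover have "(0, i) \<in> ?E\<^sup>*" if "i < Suc m" for i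
    using that by (induction i) (auto intro: rtrancl_into_rtrancl edge)
  ultimately show ?thesis using assms by (meson rtrancl_trans symD sym_rtrancl)
qed

text \<open>The left side, as a function of \<open>w\<close>, vanishes at \<open>u\<close> and rises
  by at most one along every arc, so \<open>lipschitz_le_rdist\<close> applies. Only this direction
  of the distance formula is used.\<close>

lemma lollipop_distance_ge:
  assumes "3 \<le> m" "u < m" "w < Suc m"
  shows "(if w < m then cycle_dist m u w else Suc (cycle_dist m u (m - 1)))
    \<le> rdist (parcs (lollipop (Suc m) m)) u w"
proof -
  define f where "f w = (if w < m then cycle_dist m u w else Suc (cycle_dist m u (m - 1)))" for w
  have "f y \<le> Suc (f x)" if edge: "(x, y) \<in> parcs (lollipop (Suc m) m)" for x y
  proof -
    consider "y = Suc x" "y < m" | "x = Suc y" "x < m" | "x = m - 1" "y = 0" | "x = 0" "y = m - 1"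
      | "x = m - 1" "y = m" | "x = m" "y = m - 1"
      using edge assms(1) by (auto simp: lollipop_def Let_def)
    then show ?thesis
      using assms(1,2) using cycle_dist_Suc[of m u x] cycle_dist_Suc[of m u y] cycle_dist_wrap[OF assms(2)]
      by cases (simp_all add: f_def)
  qed
  then have "f w \<le> f u + rdist (parcs (lollipop (Suc m) m)) u w"
    using assms by (intro lipschitz_le_rdist lollipop_reachable) auto
  moreover have "f u = 0" using assms by (simp add: f_def cycle_dist_def)
  ultimately show ?thesis by (simp add: f_def)
qed

lemma lollipop_total_distance_ge:
  assumes "3 \<le> m"
  shows "2 * m + (m + 2) * (m\<^sup>2 div 4)
    \<le> (\<Sum>u<Suc m. \<Sum>w<Suc m. rdist (parcs (lollipop (Suc m) m)) u w)"
proof -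
  let ?d = "rdist (parcs (lollipop (Suc m) m))"
  have sym: "?d u w = ?d w u" for u w
    by (rule rdist_sym) (auto simp: lollipop_def Let_def sym_def)
  have cyc: "m\<^sup>2 div 4 \<le> (\<Sum>w<m. ?d u w)" if "u < m" for u
    unfolding sum_cycle_dist[OF that, symmetric]
    using lollipop_distance_ge[OF assms that] by (intro sum_mono) (metis less_SucI lessThan_iff)
  \<comment> \<open>Vertex \<open>m\<close> hangs at \<open>m - 1\<close>. Its row and its column
    each give this amount, whence the \<open>2 * m\<close> and the factor
    \<open>m + 2\<close>.\<close>
  have pend: "m + m\<^sup>2 div 4 \<le> (\<Sum>u<m. ?d u m)"
  proof -
    have "cycle_dist m u (m - 1) = cycle_dist m (m - 1) u" for u
      by (simp add: cycle_dist_def add.commute)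
    then have "m + m\<^sup>2 div 4 = (\<Sum>u<m. Suc (cycle_dist m u (m - 1)))"
      using sum_cycle_dist[of "m - 1" m] assms by (simp add: sum_Suc)
    also have "\<dots> \<le> (\<Sum>u<m. ?d u m)"
      using lollipop_distance_ge[OF assms, of _ m] by (intro sum_mono) auto
    finally show ?thesis .
  qed
  have "m * (m\<^sup>2 div 4) \<le> (\<Sum>u<m. \<Sum>w<m. ?d u w)"
    using sum_mono[of "{..<m}" "\<lambda>_. m\<^sup>2 div 4" "\<lambda>u. \<Sum>w<m. ?d u w"] cyc by simp
  moreover have "(\<Sum>u<Suc m. \<Sum>w<Suc m. ?d u w)
      = (\<Sum>u<m. \<Sum>w<m. ?d u w) + (\<Sum>u<m. ?d u m) + (\<Sum>w<m. ?d w m)"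
    by (simp add: sum.distrib sym[of m])
  ultimately show ?thesis using pend by (simp add: algebra_simps)
qed

section \<open>Cut vertices in terms of relations, and comparison of the two Wiener indices\<close>

lemma cut_vertex_iff:
  assumes "pair_sym_digraph G"
  shows "cut_vertex (with_proj G) x \<longleftrightarrow> x \<in> pverts G \<and> pverts G - {x} \<noteq> {} \<and>
    \<not> (\<forall>u\<in>pverts G - {x}. \<forall>w\<in>pverts G - {x}. (u, w) \<in> (Restr (parcs G) (pverts G - {x}))\<^sup>*)"
proof -
  interpret pair_sym_digraph G by fact
  let ?D = "pre_digraph.del_vert (with_proj G) x"
  have verts: "verts ?D = pverts G - {x}" by (simp add: del_vert_simps)
  have arcs: "arcs_ends ?D = {(a, b) \<in> parcs G. a \<noteq> x \<and> b \<noteq> x}"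
    by (auto simp: arcs_ends_conv del_vert_simps)
  have "sym (arcs_ends ?D)" unfolding arcs by (auto simp: sym_def intro: arcs_symmetric)
  moreover have "Restr (arcs_ends ?D) (verts ?D) = Restr (parcs G) (pverts G - {x})"
    unfolding arcs verts by auto
  ultimately show ?thesis
    unfolding cut_vertex_def by (auto simp: connected_iff_Restr_rtrancl verts)
qed

lemma connected_with_proj_rtrancl:
  assumes "pair_sym_digraph G" "connected (with_proj G)" "u \<in> pverts G" "w \<in> pverts G"
  shows "(u, w) \<in> (parcs G)\<^sup>*"
proof -
  interpret pair_sym_digraph G by fact
  have "sym (arcs_ends (with_proj G))" by (auto simp: sym_def intro: arcs_symmetric)
  then have "(u, w) \<in> (Restr (parcs G) (pverts G))\<^sup>*"
    using assms connected_iff_Restr_rtrancl[of "with_proj G"] by simp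
  then show ?thesis by (rule rtrancl_mono[THEN subsetD, rotated]) blast
qed

lemma one_cut_graph_of_unique_cut_vertex:
  assumes "pair_graph G" "connected (with_proj G)" "{x. cut_vertex (with_proj G) x} = {v}"
  shows "one_cut_graph (pverts G) (parcs G) v"
proof -
  interpret pair_graph G by fact
  have sym_G: "pair_sym_digraph G" ..
  have cut: "cut_vertex (with_proj G) x \<longleftrightarrow> x = v" for x using assms(3) by blast
  show ?thesis
  proof
    show "finite (pverts G)" by (rule pair_finite_verts)
    show "parcs G \<subseteq> pverts G \<times> pverts G" using in_arcsD1 in_arcsD2 by auto
    show "sym (parcs G)" by (auto simp: sym_def intro: arcs_symmetric)
    show "irrefl (parcs G)" using pair_no_loops by (fastforce simp: irrefl_def)
    show "(u, w) \<in> (parcs G)\<^sup>*" if "u \<in> pverts G" "w \<in> pverts G" for u w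
      using connected_with_proj_rtrancl[OF sym_G assms(2) that] .
    show "v \<in> pverts G" using cut[of v] by (simp add: cut_vertex_def)
    show "(u, w) \<in> (Restr (parcs G) (pverts G - {x}))\<^sup>*"
      if "x \<in> pverts G" "x \<noteq> v" "u \<in> pverts G - {x}" "w \<in> pverts G - {x}" for x u w
      using cut_vertex_iff[OF sym_G, of x] cut[of x] that by blast
  qed
qed

theorem theorem5p5:
  fixes G :: "'a pair_pre_digraph" and n :: nat
  assumes "n \<ge> 7" and "G \<in> graphs_with_cut_vertices n 1"
  shows "wiener_index (with_proj G) \<le> wiener_index (with_proj (lollipop n (n - 1))) \<and>
    (wiener_index (with_proj G) = wiener_index (with_proj (lollipop n (n - 1))) \<longleftrightarrow>
       digraph_iso (with_proj G) (with_proj (lollipop n (n - 1))))"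
proof -
  have G: "pair_graph G" "connected (with_proj G)" "card (pverts G) = n"
    and "card {x. cut_vertex (with_proj G) x} = 1"
    using assms(2) by (auto simp: graphs_with_cut_vertices_def)
  then obtain v where v: "{x. cut_vertex (with_proj G) x} = {v}" by (elim card_1_singletonE)
  interpret pair_graph G by fact
  interpret cut: one_cut_graph "pverts G" "parcs G" v
    using one_cut_graph_of_unique_cut_vertex[OF G(1,2) v] .
  define m where "m = n - 1"
  have m: "n = Suc m" "6 \<le> m" using assms(1) by (auto simp: m_def)
  \<comment> \<open>\<open>T\<close> separates the doubled indices: that of \<open>G\<close> is at
    most \<open>T\<close>, that of the lollipop at least \<open>T\<close>.\<close>
  define T where "T = 2 * m + (m + 2) * (m\<^sup>2 div 4)"
  have T_int: "int T = 2 * int m + (int m + 2) * int (m\<^sup>2 div 4)" by (simp add: T_def algebra_simps)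
  let ?L = "lollipop n m"
  have L: "pair_graph ?L" using m by (intro pair_graph_lollipop) auto
  have verts_L: "pverts ?L = {..<n}" by (simp add: lollipop_def Let_def)
  have conn_L: "(u, w) \<in> (parcs ?L)\<^sup>*" if "u \<in> pverts ?L" "w \<in> pverts ?L" for u w
  proof -
    have "u < n" "w < n" using that verts_L by auto
    then show ?thesis unfolding m(1) by (rule lollipop_reachable)
  qed
  \<comment> \<open>Two vertices disconnected by the removal of \<open>v\<close> lie in different
    components.\<close>
  have two_comps: "2 \<le> card cut.comps"
  proof -
    have "cut_vertex (with_proj G) v" using v by blast
    then obtain u w where uw: "u \<in> pverts G - {v}" "w \<in> pverts G - {v}" "(u, w) \<notin> cut.R\<^sup>*"
      using cut_vertex_iff[of G v] pair_sym_digraph_axioms unfolding cut.R_def by blast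
    then have "cut.comp u \<noteq> cut.comp w" using cut.comp_self[of w] by (auto simp: cut.comp_def)
    then have "card {cut.comp u, cut.comp w} = 2" by simp
    moreover have "{cut.comp u, cut.comp w} \<subseteq> cut.comps" using uw by (auto simp: cut.comps_def)
    ultimately show ?thesis using card_mono[OF cut.finite_comps] by metis
  qed
  obtain W where W: "wiener_index (with_proj G) = ereal (real W)"
    "2 * W = (\<Sum>u\<in>pverts G. \<Sum>w\<in>pverts G. rdist (parcs G) u w)"
    using wiener_index_double_sum[OF G(1) cut.connected_E] by blast
  obtain W' where W': "wiener_index (with_proj ?L) = ereal (real W')"
    "2 * W' = (\<Sum>u\<in>pverts ?L. \<Sum>w\<in>pverts ?L. rdist (parcs ?L) u w)"
    using wiener_index_double_sum[OF L conn_L] by blast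
  have upper: "2 * W \<le> T"
  proof -
    have "int (2 * W) \<le> int T"
      unfolding W(2) T_int using cut.total_distance_le two_comps G(3) m by simp
    then show ?thesis by simp
  qed
  have lower: "T \<le> 2 * W'"
    unfolding W'(2) T_def verts_L unfolding m(1) using m(2) by (intro lollipop_total_distance_ge) simp
  \<comment> \<open>Equal Wiener indices give this premise, since the lollipop reaches
    \<open>T\<close>. The map \<open>h\<close> goes from the lollipop to \<open>G\<close>, so the
    isomorphism is inverted at the end.\<close>
  have iso: "digraph_iso (with_proj G) (with_proj ?L)" if large: "T \<le> 2 * W"
  proof -
    obtain h :: "nat \<Rightarrow> 'a" where "inj_on h {..<n}" "h ` {..<n} = pverts G"
      "map_prod h h ` parcs ?L = parcs G"
    proof (rule cut.lollipop_embedding[unfolded G(3), folded m_def])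
      show "2 * int m + (int m + 2) * int (m\<^sup>2 div 4)
          \<le> int (\<Sum>u\<in>pverts G. \<Sum>w\<in>pverts G. rdist (parcs G) u w)"
        using large unfolding T_int[symmetric] W(2)[symmetric] by (simp only: of_nat_le_iff)
    qed (use assms(1) two_comps in auto)
    then have "digraph_iso (with_proj ?L) (with_proj G)"
      using L verts_L by (intro digraph_iso_with_projI) (auto intro: pair_digraph.pair_wf_digraph pair_graph.axioms)
    moreover have "wf_digraph (with_proj ?L)"
      using L pair_graph.axioms(1) pair_digraph.pair_wf_digraph wf_digraph_wp_iff by blast
    ultimately show ?thesis by (rule digraph_iso_sym[rotated])
  qed
  have "wiener_index (with_proj G) = wiener_index (with_proj ?L)"
    if "digraph_iso (with_proj G) (with_proj ?L)"
    by (rule digraph_iso_wiener_index_eq[OF G(1) L that cut.connected_E conn_L])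
  then show ?thesis
    using iso upper lower W(1) W'(1) unfolding m_def[symmetric] by auto
qed

end
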